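(* Let $m\ge2$ be an integer. Then $$ \sum_{r=1}^{m-1}\frac rm\,\gamma_1\!\left(\frac rm\right)=\frac12\left\{(m-1)\gamma_1-m\gamma\ln m-\frac m2\ln^2m\right\}-\frac{\pi}{2m}(\gamma+\ln2\pi m)\sum_{l=1}^{m-1}l\cot\frac{\pi l}{m}-\frac\pi2\sum_{l=1}^{m-1}\cot\frac{\pi l}{m}\cdot\ln\Gamma\!\left(\frac lm\right). $$
   Context: $\zeta(s,v)$ is the Hurwitz zeta function, $\zeta(s,v)=\sum_{n\ge0}(n+v)^{-s}$ for $\operatorname{Re}s>1$, continued meromorphically in $s$. The generalized Stieltjes constants $\gamma_n(v)$ are defined by the Laurent expansion at $s=1$: $\zeta(s,v)=\frac1{s-1}+\sum_{n\ge0}\frac{(-1)^n(s-1)^n}{n!}\gamma_n(v)$; the Stieltjes constants are $\gamma_n=\gamma_n(1)$, and $\gamma=\gamma_0$ is Euler's constant. $\ln2\pi m=\ln(2\pi m)$, $\ln^2x=(\ln x)^2$. *)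

theory Defs
  imports "HOL-Complex_Analysis.Complex_Analysis"
begin

text \<open>
  The parameter \<open>v\<close> is meant to satisfy \<open>Re v > 0\<close>, so that the principal branch taken by
  \<open>powr\<close> gives \<open>(n + v)\<^sup>-\<^sup>s\<close> its usual meaning. Being nicely meromorphic on the whole plane fixes
  the function everywhere: it is continuous off its poles and has the conventional value 0 at
  them. Hence it is determined by its values for \<open>Re s > 1\<close>.
\<close>

definition hurwitz_zeta :: "complex \<Rightarrow> complex \<Rightarrow> complex" where
  "hurwitz_zeta v =
     (THE Z. Z nicely_meromorphic_on UNIV \<and>
        (\<forall>s. Re s > 1 \<longrightarrow> (\<lambda>n. (of_nat n + v) powr (-s)) sums Z s))"

text \<open>
  The coefficient of \<open>(s - 1)\<^sup>n\<close> in the Laurent expansion of \<open>\<zeta>(s, v)\<close> at \<open>s = 1\<close> is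
  \<open>(-1)\<^sup>n \<gamma>\<^sub>n(v) / n!\<close>.
\<close>

definition stieltjes_gamma :: "nat \<Rightarrow> complex \<Rightarrow> complex" where
  "stieltjes_gamma n v =
     (-1) ^ n * fact n * fls_nth (laurent_expansion (hurwitz_zeta v) 1) (int n)"

end

(*
  For real v > 0 put E(s, v) = (s - 1) zeta(s, v), which is holomorphic near s = 1 with
  gamma_1(v) = - E''(1, v) / 2. Pairing r with m - r gives
    2 sum (r/m) gamma_1(r/m) = sum gamma_1(r/m) + sum (r/m) (gamma_1(r/m) - gamma_1(1 - r/m)).
  The first sum follows from the distribution relation sum_{r=1..m} zeta(s, r/m) = m^s zeta(s, 1).
  The differences come from W_v(s) = sum_k ((k + v)^-s - (k + 1 - v)^-s), which converges for s > 0.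
  On 0 < s < 1 its Mellin integral is, by finite Fourier analysis, a combination over l of Mellin
  integrals of the conjugate Poisson kernels Im 1/(1 - exp(-u + 2 pi i l/m)); expanding these in
  partial fractions gives a functional equation relating W_{r/m}(s) to the W_{l/m}(1 - s). Letting
  s tend to 1, the value and the derivative of W_x at 0 are 1 - 2x and
  ln Gamma(x) - ln Gamma(1 - x), which leads to gamma_1(r/m) - gamma_1(1 - r/m). The cotangents
  arise from sum_l l sin(2 pi r l/m) = - (m/2) cot(pi r/m).
*)

theory Submission
  imports Defs "HOL-Real_Asymp.Real_Asymp"
begin

section \<open>Analytic continuation of the Hurwitz zeta function\<close>

text \<open>\<open>hurwitz_zeta\<close> is a definite description over functions on the whole plane,
  so nothing can be said about it before a continuation to the whole plane exists and is unique,
  although the Stieltjes constants only concern a neighbourhood of s = 1. Once that is settled, all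
  work takes place on Re s > 0. In zeta(s, v) - zeta(s, 1 - v) the poles at 1 cancel, and the paired
  series converges on both sides of the reflection s -> 1 - s, so real s in (0, 1) suffice. The
  price is that s = 1 is only a boundary point; since E is already known to be holomorphic there, a
  one-sided limit still determines the second derivative. Rational parameters enter through
  periodicity: exp (2 pi i l / m) is an m-th root of unity, so sine orthogonality over l isolates
  the residue classes r and m - r. Euler's constant arises twice: as E'(1, 1), next to ln m in the
  distribution relation, and as - Gamma'(1), next to ln (2 pi m), from differentiating the factor of
  the functional equation.\<close>

lemma holomorphic_series:
  fixes f :: "nat \<Rightarrow> complex \<Rightarrow> complex"
  assumes S: "open S" and holo: "\<And>n. f n holomorphic_on S"
    and bound: "\<And>x. x \<in> S \<Longrightarrow> \<exists>d h. d > 0 \<and> summable h \<and> (\<forall>n. \<forall>y\<in>ball x d \<inter> S. norm (f n y) \<le> h n)"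
  shows "(\<lambda>s. \<Sum>n. f n s) holomorphic_on S"
    and "x \<in> S \<Longrightarrow> (\<lambda>n. f n x) sums (\<Sum>n. f n x)"
    and "x \<in> S \<Longrightarrow> (\<lambda>n. deriv (f n) x) sums deriv (\<lambda>s. \<Sum>n. f n s) x"
proof -
  have hfd: "(f n has_field_derivative deriv (f n) x) (at x)" if "x \<in> S" for n x
    using holomorphic_derivI[OF holo S that] .
  have "\<exists>g g'. \<forall>x \<in> S. ((\<lambda>n. f n x) sums g x) \<and> ((\<lambda>n. deriv (f n) x) sums g' x)
           \<and> (g has_field_derivative g' x) (at x)"
  proof (rule series_and_derivative_comparison_local[OF S hfd])
    fix x assume "x \<in> S"
    from bound[OF this] obtain d h where "d > 0" "summable h"
      "\<forall>n. \<forall>y\<in>ball x d \<inter> S. norm (f n y) \<le> h n" by blast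
    thus "\<exists>d h. 0 < d \<and> summable h \<and> (\<forall>\<^sub>F n in sequentially. \<forall>y\<in>ball x d \<inter> S. cmod (f n y) \<le> h n)"
      by (intro exI[of _ d] exI[of _ h]) auto
  qed
  then obtain g g' where g: "\<And>x. x \<in> S \<Longrightarrow> (\<lambda>n. f n x) sums g x"
    "\<And>x. x \<in> S \<Longrightarrow> (\<lambda>n. deriv (f n) x) sums g' x"
    "\<And>x. x \<in> S \<Longrightarrow> (g has_field_derivative g' x) (at x)" by blast
  have eq: "g x = (\<Sum>n. f n x)" if "x \<in> S" for x
    using g(1)[OF that] by (simp add: sums_iff)
  have der: "((\<lambda>s. \<Sum>n. f n s) has_field_derivative g' x) (at x)" if "x \<in> S" for x
    by (rule has_field_derivative_transform_within_open[OF g(3)[OF that] S that]) (simp add: eq)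
  show "(\<lambda>s. \<Sum>n. f n s) holomorphic_on S"
    using der S holomorphic_on_open by blast
  show "x \<in> S \<Longrightarrow> (\<lambda>n. f n x) sums (\<Sum>n. f n x)"
    using g(1) eq by simp
  show "x \<in> S \<Longrightarrow> (\<lambda>n. deriv (f n) x) sums deriv (\<lambda>s. \<Sum>n. f n s) x"
    using g(2) der DERIV_imp_deriv by metis
qed

section \<open>Taylor remainders of complex powers\<close>

lemma open_Re_gt: "open {s. Re s > c}"
  by (rule open_halfspace_Re_gt)

lemma summable_shifted_powr:
  assumes "v > 0" "a > (1 :: real)"
  shows "summable (\<lambda>n. (real n + v) powr (-a))"
proof (rule summable_comparison_test_ev)
  show "summable (\<lambda>n. real n powr (-a))"
    using assms by (simp add: summable_real_powr_iff)
  show "\<forall>\<^sub>F n in sequentially. norm ((real n + v) powr - a) \<le> real n powr - a"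
    using eventually_gt_at_top[of 0]
    by eventually_elim (use assms in \<open>auto intro!: powr_mono2'\<close>)
qed

lemma norm_of_real_powr:
  "x > 0 \<Longrightarrow> norm (of_real x powr (s :: complex)) = x powr Re s"
  by (simp add: norm_powr_real_powr)

text \<open>Taylor's formula for z powr w on the segment from y to y + 1. The bound on Re w makes
  the modulus of the derivative of order J + 1 decrease along the segment, so it is largest at the
  left end y; the factor 1 / J! is dropped.\<close>

lemma powr_taylor_bound:
  fixes w :: complex and y :: real and J :: nat
  assumes y: "y > 0" and w: "Re w \<le> real J + 1"
  shows "norm (of_real (y + 1) powr w - (\<Sum>j\<le>J. (w gchoose j) * of_real y powr (w - of_nat j)))
           \<le> norm (\<Prod>i<Suc J. w - of_nat i) * y powr (Re w - real J - 1)"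
proof -
  define f where "f = (\<lambda>(i::nat) z. (\<Prod>k<i. w - of_nat k) * z powr (w - of_nat i))"
  let ?S = "closed_segment (complex_of_real y) (complex_of_real (y + 1))"
  have S: "\<exists>t\<ge>y. x = of_real t" if "x \<in> ?S" for x
  proof -
    from that have "x \<in> of_real ` closed_segment y (y+1)"
      by (simp only: closed_segment_of_real)
    thus ?thesis by (auto simp: closed_segment_eq_real_ivl)
  qed
  define B where "B = norm (\<Prod>i<Suc J. w - of_nat i) * y powr (Re w - real J - 1)"
  have "cmod (f 0 (of_real (y+1)) - (\<Sum>i\<le>J. f i (of_real y) * (of_real (y+1) - of_real y) ^ i / (fact i)))
      \<le> B * cmod (of_real (y+1) - of_real y) ^ (Suc J) / fact J"
  proof (rule complex_Taylor[where S = ?S])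
    fix i x assume x: "x \<in> ?S"
    then obtain t where t: "t \<ge> y" "x = of_real t" using S by blast
    have nn: "x \<notin> \<real>\<^sub>\<le>\<^sub>0" using t y by (auto simp: complex_nonpos_Reals_iff)
    show "(f i has_field_derivative f (Suc i) x) (at x within ?S)"
      unfolding f_def using nn
      by (auto intro!: derivative_eq_intros simp: algebra_simps)
  next
    fix x assume x: "x \<in> ?S"
    then obtain t where t: "t \<ge> y" "x = of_real t" using S by blast
    have "t powr (Re w - real J - 1) \<le> y powr (Re w - real J - 1)"
      using t y w by (intro powr_mono2') auto
    hence "norm (\<Prod>i<Suc J. w - of_nat i) * t powr (Re w - real J - 1) \<le> B"
      unfolding B_def by (intro mult_left_mono) auto
    moreover have "norm (x powr (w - of_nat (Suc J))) = t powr (Re w - real J - 1)"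
      using t y by (simp add: norm_of_real_powr algebra_simps)
    ultimately show "cmod (f (Suc J) x) \<le> B"
      unfolding f_def norm_mult by simp
  qed auto
  also have "\<dots> \<le> B"
  proof -
    have "B * 1 \<le> B * fact J"
      by (intro mult_left_mono) (auto simp: B_def)
    thus ?thesis by (simp add: divide_simps)
  qed
  also have "f 0 (of_real (y+1)) = of_real (y + 1) powr w" by (simp add: f_def)
  also have "(\<Sum>i\<le>J. f i (of_real y) * (of_real (y+1) - of_real y) ^ i / (fact i)) =
     (\<Sum>j\<le>J. (w gchoose j) * of_real y powr (w - of_nat j))"
    by (intro sum.cong refl) (simp add: f_def gbinomial_prod_rev atLeast0LessThan)
  finally show ?thesis unfolding B_def .
qed

text \<open>
  The remainder of the Taylor polynomial of degree \<open>J\<close> of \<open>y powr (1 - s)\<close> at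
  \<open>y = n + v\<close>, evaluated at \<open>y + 1\<close>. It is \<open>O(n powr (- Re s - J))\<close>, whereas for
  \<open>Re s > 1\<close> its sum over \<open>n\<close> telescopes into values of the Hurwitz zeta function
  at \<open>s, s + 1, ..., s + J - 1\<close>.
\<close>

definition hz_term :: "real \<Rightarrow> nat \<Rightarrow> nat \<Rightarrow> complex \<Rightarrow> complex" where
  "hz_term v J n s = of_real (real n + v + 1) powr (1 - s)
     - (\<Sum>j\<le>J. ((1 - s) gchoose j) * of_real (real n + v) powr (1 - s - of_nat j))"

definition hz_rem :: "real \<Rightarrow> nat \<Rightarrow> complex \<Rightarrow> complex" where
  "hz_rem v J s = (\<Sum>n. hz_term v J n s)"

definition hz_series :: "real \<Rightarrow> complex \<Rightarrow> complex" where
  "hz_series v s = (\<Sum>n. of_real (real n + v) powr (- s))"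

text \<open>\<open>hz_reg v s\<close> is \<open>(s - 1) \<zeta>(s, v)\<close> on \<open>Re s > 0\<close>, where it has no pole.\<close>

definition hz_reg :: "real \<Rightarrow> complex \<Rightarrow> complex" where
  "hz_reg v s = of_real v powr (1 - s) + hz_rem v 1 s"

lemma holomorphic_gbinomial [holomorphic_intros]:
  "f holomorphic_on A \<Longrightarrow> (\<lambda>s. f s gchoose j :: complex) holomorphic_on A"
  unfolding gbinomial_prod_rev by (intro holomorphic_intros) auto

context
  fixes v :: real
  assumes v: "v > 0"
begin

lemma holomorphic_hz_term: "hz_term v J n holomorphic_on A"
  unfolding hz_term_def using v
  by (intro holomorphic_intros) (auto simp: complex_nonpos_Reals_iff)

lemma hz_term_bound:
  assumes x: "Re x > 1 - real J"
  shows "\<exists>d h. d > 0 \<and> summable h \<and>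
     (\<forall>n. \<forall>y\<in>ball x d \<inter> {s. Re s > 1 - real J}. norm (hz_term v J n y) \<le> h n)"
proof -
  \<comment> \<open>Half the distance from x to the line Re = 1 - J: on the ball of this radius the
    exponent stays below - (1 + d), which gives a summable majorant uniform in y.\<close>
  define d where "d = (Re x - (1 - real J)) / 2"
  have d: "d > 0" using x by (simp add: d_def)
  define C where "C = (norm x + d + 1 + real J) ^ Suc J"
  define a where "a = 1 + d"
  show ?thesis
  proof (intro exI[of _ d] exI[of _ "\<lambda>n. (C * max 1 (v powr (- (2*d)))) * (real n + v) powr (-a)"] conjI allI ballI)
    show "summable (\<lambda>n. (C * max 1 (v powr (- (2*d)))) * (real n + v) powr (-a))"
      by (intro summable_mult summable_shifted_powr) (use v d in \<open>auto simp: a_def\<close>)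
    fix n y assume y: "y \<in> ball x d \<inter> {s. Re s > 1 - real J}"
    define p where "p = real n + v"
    have p: "p > 0" "p \<ge> v" using v by (auto simp: p_def)
    have dist: "norm (x - y) < d" using y by (simp add: dist_norm)
    have Re_y: "Re y > Re x - d" "Re y < Re x + d"
      using abs_Re_le_cmod[of "x - y"] dist by auto
    have "norm (hz_term v J n y) \<le>
       norm (\<Prod>i<Suc J. (1 - y) - of_nat i) * p powr (Re (1 - y) - real J - 1)"
      unfolding hz_term_def
      using powr_taylor_bound[of p "1 - y" J] p y by (simp add: p_def)
    also have "\<dots> \<le> C * (max 1 (v powr (- (2*d))) * p powr (-a))"
    proof (intro mult_mono)
      have "norm (\<Prod>i<Suc J. (1 - y) - of_nat i) = (\<Prod>i<Suc J. norm ((1 - y) - of_nat i))"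
        by (simp add: prod_norm)
      also have "\<dots> \<le> (\<Prod>i<Suc J. norm x + d + 1 + real J)"
      proof (intro prod_mono conjI)
        fix i assume i: "i \<in> {..<Suc J}"
        have "norm ((1 - y) - of_nat i) \<le> norm (1 - y) + norm (of_nat i :: complex)"
          by (rule norm_triangle_ineq4)
        also have "norm (1 - y) \<le> 1 + norm y" using norm_triangle_ineq4[of 1 y] by simp
        also have "norm y \<le> norm x + d"
          using norm_triangle_ineq2[of y x] dist by (simp add: norm_minus_commute)
        finally show "norm ((1 - y) - of_nat i) \<le> norm x + d + 1 + real J" using i by simp
      qed auto
      also have "\<dots> = C" unfolding C_def by simp
      finally show "norm (\<Prod>i<Suc J. (1 - y) - of_nat i) \<le> C" .
      \<comment> \<open>By how much the decay exponent exceeds 1 + d. Since n + v may be smaller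
        than 1, the factor p powr (-e) is bounded separately for p >= 1 and p < 1, whence the
        maximum in the majorant.\<close>
      define e where "e = Re y - (Re x - d)"
      have e: "0 < e" "e < 2 * d" using Re_y by (auto simp: e_def)
      have "p powr (Re (1 - y) - real J - 1) = p powr (-e) * p powr (-a)"
        by (simp add: powr_add [symmetric] e_def a_def d_def add_divide_distrib diff_divide_distrib)
      also have "p powr (-e) \<le> max 1 (v powr (- (2*d)))"
      proof (cases "p \<ge> 1")
        case True
        hence "p powr (-e) \<le> p powr 0" using e by (intro powr_mono) auto
        thus ?thesis using True by auto
      next
        case False
        hence "p powr (-e) \<le> p powr (- (2*d))" using e p by (intro powr_mono') auto
        also have "\<dots> \<le> v powr (- (2*d))" using p v d by (intro powr_mono2') auto
        finally show ?thesis by simp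
      qed
      finally show "p powr (Re (1 - y) - real J - 1) \<le> max 1 (v powr (- (2*d))) * p powr (-a)"
        by (simp add: mult_right_mono)
    qed (use d in \<open>auto simp: C_def\<close>)
    finally show "norm (hz_term v J n y) \<le> (C * max 1 (v powr (- (2*d)))) * (real n + v) powr (-a)"
      by (simp add: p_def mult_ac)
  qed (use d in auto)
qed

lemma holomorphic_hz_rem: "hz_rem v J holomorphic_on {s. Re s > 1 - real J}"
  unfolding hz_rem_def[abs_def]
  by (rule holomorphic_series(1)[OF open_Re_gt holomorphic_hz_term hz_term_bound]) auto

lemma hz_rem_sums: "Re s > 1 - real J \<Longrightarrow>
    (\<lambda>n. hz_term v J n s) sums hz_rem v J s"
  unfolding hz_rem_def[abs_def]
  by (rule holomorphic_series(2)[OF open_Re_gt holomorphic_hz_term hz_term_bound]) auto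

lemma deriv_hz_rem_sums: "Re s > 1 - real J \<Longrightarrow>
    (\<lambda>n. deriv (hz_term v J n) s) sums deriv (hz_rem v J) s"
  unfolding hz_rem_def[abs_def]
  by (rule holomorphic_series(3)[OF open_Re_gt holomorphic_hz_term hz_term_bound]) auto

end

section \<open>Meromorphic continuation to the whole plane and its uniqueness\<close>

lemma connected_Re_gt: "connected {s. Re s > c}"
  by (intro convex_connected convex_halfspace_Re_gt)

context
  fixes v :: real
  assumes v: "v > 0"
begin

lemma hz_series_sums:
  assumes "Re s > 1"
  shows "(\<lambda>n. of_real (real n + v) powr (- s)) sums hz_series v s"
proof -
  have "norm (complex_of_real (real n + v) powr (- s)) = (real n + v) powr (- Re s)" for n
    using v by (subst norm_of_real_powr) auto
  hence "summable (\<lambda>n. norm (complex_of_real (real n + v) powr (- s)))"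
    using summable_shifted_powr[OF v assms] by simp
  thus ?thesis unfolding hz_series_def by (rule summable_sums[OF summable_norm_cancel])
qed

lemma powr_telescope_sums:
  fixes s :: complex
  assumes "Re s > 1"
  shows "(\<lambda>n. of_real (real n + v + 1) powr (1 - s) - of_real (real n + v) powr (1 - s))
           sums (- (of_real v powr (1 - s)))"
proof -
  have "(\<lambda>n. complex_of_real (real n + v) powr (1 - s)) \<longlonglongrightarrow> 0"
  proof (rule tendsto_neg_powr_complex_of_real)
    show "filterlim (\<lambda>n. real n + v) at_top sequentially"
      by (rule filterlim_at_top_mono[OF filterlim_real_sequentially]) (use v in auto)
  qed (use assms in auto)
  from telescope_sums[OF this] show ?thesis by (simp add: algebra_simps)
qed

text \<open>In the summed Taylor expansion the terms with j = 0 telescope against the shifted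
  powers, j = 1 contributes (1 - s) zeta(s, v), and every j >= 2 involves zeta at a point at least
  one unit further right. Solving for the term j = 1 expresses zeta through values to the right and
  \<open>hz_rem\<close>, which is holomorphic on Re s > 1 - J.\<close>

lemma hz_series_recursion:
  assumes s: "Re s > 1" and J: "J \<ge> 1"
  shows "(s - 1) * hz_series v s = of_real v powr (1 - s)
           + (\<Sum>j=2..J. ((1 - s) gchoose j) * hz_series v (s + of_nat j - 1)) + hz_rem v J s"
proof -
  have split: "(\<Sum>j\<le>J. g j) = g 0 + (g 1 + (\<Sum>j=2..J. g j))" for g :: "nat \<Rightarrow> complex"
  proof -
    have "{..J} = insert 0 (insert 1 {2..J})" using J by auto
    thus ?thesis by simp
  qed
  have "(\<lambda>n. (of_real (real n + v + 1) powr (1 - s) - of_real (real n + v) powr (1 - s))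
          - ((1 - s) * of_real (real n + v) powr (- s)
            + (\<Sum>j=2..J. ((1 - s) gchoose j) * of_real (real n + v) powr (- (s + of_nat j - 1)))))
        sums (- (of_real v powr (1 - s)) - ((1 - s) * hz_series v s
            + (\<Sum>j=2..J. ((1 - s) gchoose j) * hz_series v (s + of_nat j - 1))))"
    by (intro sums_diff sums_add sums_sum sums_mult powr_telescope_sums hz_series_sums s)
       (use s in auto)
  also have "(\<lambda>n. (of_real (real n + v + 1) powr (1 - s) - of_real (real n + v) powr (1 - s))
          - ((1 - s) * of_real (real n + v) powr (- s)
            + (\<Sum>j=2..J. ((1 - s) gchoose j) * of_real (real n + v) powr (- (s + of_nat j - 1)))))
      = (\<lambda>n. hz_term v J n s)"
    unfolding hz_term_def split by (simp add: algebra_simps)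
  finally have "(\<lambda>n. hz_term v J n s) sums (- (of_real v powr (1 - s)) - ((1 - s) * hz_series v s
            + (\<Sum>j=2..J. ((1 - s) gchoose j) * hz_series v (s + of_nat j - 1))))" .
  moreover have "(\<lambda>n. hz_term v J n s) sums hz_rem v J s"
    using s by (intro hz_rem_sums v) auto
  ultimately have "hz_rem v J s = - (of_real v powr (1 - s)) - ((1 - s) * hz_series v s
            + (\<Sum>j=2..J. ((1 - s) gchoose j) * hz_series v (s + of_nat j - 1)))"
    by (rule sums_unique2[rotated])
  thus ?thesis by (simp add: algebra_simps)
qed

text \<open>Each induction step gains one unit: in the recursion with one more Taylor term, the
  arguments s + j - 1 with j >= 2 lie in the half-plane already reached. Poles are not tracked;
  plain meromorphy is enough, as the values at singular points are normalised afterwards.\<close>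

lemma hz_series_continuation_halfplane:
  "\<exists>Z. Z meromorphic_on {s. Re s > 1 - real (Suc J)} \<and> (\<forall>s. Re s > 1 \<longrightarrow> Z s = hz_series v s)"
proof (induction J)
  case 0
  define Z where "Z = (\<lambda>s. (of_real v powr (1 - s) + hz_rem v 1 s) / (s - 1))"
  have "Z meromorphic_on {s. Re s > 1 - real 1}"
    unfolding Z_def using v
    by (intro meromorphic_intros analytic_on_imp_meromorphic_on analytic_intros
        ) (auto simp: analytic_on_open open_Re_gt complex_nonpos_Reals_iff intro!: holomorphic_hz_rem[of v 1, simplified])
  moreover have "Z s = hz_series v s" if "Re s > 1" for s
  proof -
    have "Z s = ((s - 1) * hz_series v s) / (s - 1)"
      unfolding Z_def by (subst hz_series_recursion[OF that, of 1]) simp_all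
    thus ?thesis using that by auto
  qed
  ultimately show ?case by (intro exI[of _ Z]) auto
next
  case (Suc J)
  then obtain Z' where Z': "Z' meromorphic_on {s. Re s > 1 - real (Suc J)}"
    "\<And>s. Re s > 1 \<Longrightarrow> Z' s = hz_series v s" by blast
  define K where "K = Suc (Suc J)"
  let ?H = "{s. Re s > 1 - real K}"
  define Z where "Z = (\<lambda>s. (of_real v powr (1 - s)
     + (\<Sum>j=2..K. ((1 - s) gchoose j) * Z' (s + of_nat j - 1)) + hz_rem v K s) / (s - 1))"
  have Z'_shift: "(\<lambda>s. Z' (s + of_nat j - 1)) meromorphic_on ?H" if "j \<ge> 2" for j
    by (rule meromorphic_on_compose[OF Z'(1)])
       (use that in \<open>auto intro!: analytic_intros simp: K_def\<close>)
  have g: "(\<lambda>s. (1 - s) gchoose j) meromorphic_on ?H" for j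
    by (intro analytic_on_imp_meromorphic_on)
       (auto simp: analytic_on_open open_Re_gt intro!: holomorphic_intros)
  have p: "(\<lambda>s. of_real v powr (1 - s)) meromorphic_on ?H"
    by (intro analytic_on_imp_meromorphic_on)
       (use v in \<open>auto simp: analytic_on_open open_Re_gt complex_nonpos_Reals_iff intro!: holomorphic_intros\<close>)
  have r: "hz_rem v K meromorphic_on ?H"
    by (intro analytic_on_imp_meromorphic_on)
       (auto simp: analytic_on_open open_Re_gt intro!: holomorphic_hz_rem v)
  have "Z meromorphic_on ?H"
    unfolding Z_def by (intro meromorphic_intros Z'_shift g p r) auto
  moreover have "Z s = hz_series v s" if "Re s > 1" for s
  proof -
    have "(\<Sum>j=2..K. ((1 - s) gchoose j) * Z' (s + of_nat j - 1)) =
          (\<Sum>j=2..K. ((1 - s) gchoose j) * hz_series v (s + of_nat j - 1))"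
      using that by (intro sum.cong refl arg_cong2[where f = "(*)"] Z'(2)) auto
    hence "Z s = ((s - 1) * hz_series v s) / (s - 1)"
      unfolding Z_def by (subst hz_series_recursion[OF that, of K]) (simp_all add: K_def)
    thus ?thesis using that by auto
  qed
  ultimately show ?case unfolding K_def by blast
qed

end

text \<open>The identity theorem for the difference with its removable singularities filled in shows
  that f and g agree near every point of A, except possibly at the point itself. That exception
  disappears because a nicely meromorphic function is determined at a point by its values around
  it.\<close>

lemma nicely_meromorphic_on_unique:
  assumes "f nicely_meromorphic_on A" "g nicely_meromorphic_on A" "open A" "connected A"
    and z: "z \<in> A" and eq: "eventually (\<lambda>w. f w = g w) (at z)" and w: "w \<in> A"
  shows "f w = g w"
proof -
  have mero: "f meromorphic_on A" "g meromorphic_on A"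
    using assms by (auto simp: nicely_meromorphic_on_def)
  have d: "(\<lambda>w. f w - g w) meromorphic_on A"
    using mero by (intro meromorphic_intros)
  have nice: "remove_sings (\<lambda>w. f w - g w) nicely_meromorphic_on A"
    using d by (rule remove_sings_nicely_meromorphic)
  have iso: "isolated_singularity_at (\<lambda>w. f w - g w) x" if "x \<in> A" for x
    using d that by (meson meromorphic_on_isolated_singularity meromorphic_on_subset empty_subsetI insert_subset)
  have "eventually (\<lambda>w. remove_sings (\<lambda>w. f w - g w) w = 0) (at z)"
    using eventually_remove_sings_eq_at[OF iso[OF z]] eq by eventually_elim simp
  hence "frequently (\<lambda>w. remove_sings (\<lambda>w. f w - g w) w = 0) (at z)"
    by (intro eventually_frequently) auto
  from frequently_eq_meromorphic_imp_constant[OF this nice assms(3,4) z]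
  have 0: "remove_sings (\<lambda>w. f w - g w) x = 0" if "x \<in> A" for x using that by blast
  have "eventually (\<lambda>x. x \<in> A) (at w)"
    using w \<open>open A\<close> by (intro eventually_at_in_open')
  hence ev: "eventually (\<lambda>x. f x = g x) (at w)"
    using eventually_remove_sings_eq_at[OF iso[OF w]] by eventually_elim (simp add: 0)
  \<comment> \<open>Either the value is the limit or the point is a pole and the value is 0; both
    alternatives depend only on the punctured neighbourhood, on which f and g coincide.\<close>
  have f: "is_pole f w \<and> f w = 0 \<or> f \<midarrow>w\<rightarrow> f w" and g: "is_pole g w \<and> g w = 0 \<or> g \<midarrow>w\<rightarrow> g w"
    using assms(1,2) w by (auto simp: nicely_meromorphic_on_def)
  have pole: "is_pole f w \<longleftrightarrow> is_pole g w" by (intro is_pole_cong ev refl)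
  have lim: "f \<midarrow>w\<rightarrow> c \<longleftrightarrow> g \<midarrow>w\<rightarrow> c" for c by (intro tendsto_cong ev)
  show ?thesis
  proof (cases "is_pole f w")
    case True
    hence "\<not> f \<midarrow>w\<rightarrow> f w" "\<not> g \<midarrow>w\<rightarrow> g w"
      using pole not_tendsto_and_filterlim_at_infinity[of "at w"] by (auto simp: is_pole_def)
    thus ?thesis using f g by simp
  next
    case False
    hence "f \<midarrow>w\<rightarrow> f w" "f \<midarrow>w\<rightarrow> g w" using f g pole lim by auto
    thus ?thesis using LIM_unique by blast
  qed
qed

context
  fixes v :: real
  assumes v: "v > 0"
begin

text \<open>The half-planes are nested and exhaust the plane, and uniqueness on the smaller one
  makes the continuations compatible, so they glue.\<close>

lemma hz_series_continuation:
  "\<exists>Z. Z nicely_meromorphic_on UNIV \<and> (\<forall>s. Re s > 1 \<longrightarrow> Z s = hz_series v s)"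
proof -
  obtain Z0 where Z0: "\<And>J. Z0 J meromorphic_on {s. Re s > 1 - real (Suc J)}"
    "\<And>J s. Re s > 1 \<Longrightarrow> Z0 J s = hz_series v s"
    using hz_series_continuation_halfplane[OF v] by metis
  define H where "H = (\<lambda>J. {s. Re s > 1 - real (Suc J)})"
  define Z where "Z = (\<lambda>J. remove_sings (Z0 J))"
  have nice: "Z J nicely_meromorphic_on H J" for J
    unfolding Z_def H_def by (intro remove_sings_nicely_meromorphic Z0)
  \<comment> \<open>Holomorphy of the series guarantees that filling in removable singularities does
    not alter any value on Re s > 1.\<close>
  have hol: "hz_series v holomorphic_on {s. Re s > 1}"
  proof -
    have "(\<lambda>s. (of_real v powr (1 - s) + hz_rem v 1 s) / (s - 1)) holomorphic_on {s. Re s > 1}"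
      using v by (intro holomorphic_intros holomorphic_on_subset[OF holomorphic_hz_rem[OF v, of 1]])
        (auto simp: complex_nonpos_Reals_iff)
    moreover have "(of_real v powr (1 - s) + hz_rem v 1 s) / (s - 1) = hz_series v s" if "Re s > 1" for s
    proof -
      have "(of_real v powr (1 - s) + hz_rem v 1 s) / (s - 1) = ((s - 1) * hz_series v s) / (s - 1)"
        by (subst hz_series_recursion[OF v that, of 1]) simp_all
      thus ?thesis using that by auto
    qed
    ultimately show ?thesis by (rule holomorphic_transform) auto
  qed
  have Z_eq: "Z J s = hz_series v s" if s: "Re s > 1" for J s
  proof -
    have "Z0 J holomorphic_on {s. Re s > 1}"
      using hol by (rule holomorphic_transform) (simp add: Z0)
    hence "Z0 J analytic_on {s}"
      using s by (auto simp: analytic_at intro!: exI[of _ "{s. Re s > 1}"] open_Re_gt)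
    thus ?thesis using Z0(2)[OF s] by (simp add: Z_def)
  qed
  have Z_mono: "Z J s = Z K s" if "s \<in> H J" "J \<le> K" for J K s
  proof (rule nicely_meromorphic_on_unique[of "Z J" "H J" "Z K" 2 s])
    show "Z K nicely_meromorphic_on H J"
      by (rule nicely_meromorphic_on_subset[OF nice]) (use that in \<open>auto simp: H_def\<close>)
    show "\<forall>\<^sub>F w in at 2. Z J w = Z K w"
      using eventually_at_in_open'[OF open_Re_gt[of 1], of 2]
      by (auto elim!: eventually_mono simp: Z_eq)
  qed (use that nice in \<open>auto simp: H_def open_Re_gt connected_Re_gt\<close>)
  \<comment> \<open>An index whose half-plane contains s; any larger index gives the same
    value.\<close>
  define N where "N = (\<lambda>s. nat \<lceil>1 - Re s\<rceil>)"
  have N: "s \<in> H (N s)" for s unfolding N_def H_def by simp linarith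
  define X where "X = (\<lambda>s. Z (N s) s)"
  have X: "X s = Z J s" if "s \<in> H J" for J s
    unfolding X_def using Z_mono[OF that, of "N s"] Z_mono[OF N, of s J] nat_le_linear[of J "N s"]
    by argo
  have "X nicely_meromorphic_on {z}" for z
  proof -
    define J where "J = N z"
    have z: "z \<in> H J" using N by (simp add: J_def)
    have "eventually (\<lambda>w. w \<in> H J) (nhds z)"
      using z by (intro eventually_nhds_in_open) (auto simp: H_def open_Re_gt)
    hence ev: "eventually (\<lambda>w. X w = Z J w) (nhds z)"
      by eventually_elim (rule X)
    hence ev': "eventually (\<lambda>w. X w = Z J w) (at z)" by (simp add: eventually_nhds_conv_at)
    have "Z J nicely_meromorphic_on {z}"
      by (rule nicely_meromorphic_on_subset[OF nice]) (use z in auto)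
    moreover have "X meromorphic_on {z} \<longleftrightarrow> Z J meromorphic_on {z}"
      by (rule meromorphic_on_cong) (use ev' in auto)
    moreover have "is_pole X z \<longleftrightarrow> is_pole (Z J) z" by (intro is_pole_cong ev' refl)
    moreover have "X \<midarrow>z\<rightarrow> c \<longleftrightarrow> Z J \<midarrow>z\<rightarrow> c" for c by (intro tendsto_cong ev')
    moreover have "X z = Z J z" using z by (rule X)
    ultimately show ?thesis by (simp add: nicely_meromorphic_on_def)
  qed
  hence "X nicely_meromorphic_on UNIV"
    unfolding nicely_meromorphic_on_def meromorphic_on_def by auto
  moreover have "X s = hz_series v s" if "Re s > 1" for s
    using X[of s 0] Z_eq[OF that] that by (auto simp: H_def)
  ultimately show ?thesis by blast
qed

text \<open>Existence and uniqueness turn the definite description into two usable facts; later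
  arguments rely on these alone.\<close>

lemma hurwitz_zeta_properties:
  "hurwitz_zeta (of_real v) nicely_meromorphic_on UNIV"
  "Re s > 1 \<Longrightarrow> hurwitz_zeta (of_real v) s = hz_series v s"
proof -
  define P where "P = (\<lambda>Z. Z nicely_meromorphic_on UNIV \<and>
        (\<forall>s. Re s > 1 \<longrightarrow> (\<lambda>n. (of_nat n + complex_of_real v) powr (-s)) sums Z s))"
  have P_iff: "P Z \<longleftrightarrow> Z nicely_meromorphic_on UNIV \<and> (\<forall>s. Re s > 1 \<longrightarrow> Z s = hz_series v s)" for Z
    unfolding P_def using hz_series_sums[OF v] by (auto simp: sums_iff)
  have "\<exists>!Z. P Z"
  proof (rule ex_ex1I)
    show "\<exists>Z. P Z" unfolding P_iff by (rule hz_series_continuation)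
    fix Y Z assume "P Y" "P Z"
    show "Y = Z"
    proof
      fix w show "Y w = Z w"
      proof (rule nicely_meromorphic_on_unique[of Y UNIV Z 2 w])
        show "\<forall>\<^sub>F w in at 2. Y w = Z w"
          using eventually_at_in_open'[OF open_Re_gt[of 1], of 2] \<open>P Y\<close> \<open>P Z\<close>
          by (auto elim!: eventually_mono simp: P_iff)
      qed (use \<open>P Y\<close> \<open>P Z\<close> in \<open>auto simp: P_iff\<close>)
    qed
  qed
  hence "P (THE Z. P Z)" by (rule theI')
  hence "P (hurwitz_zeta (of_real v))" unfolding hurwitz_zeta_def P_def by simp
  thus "hurwitz_zeta (of_real v) nicely_meromorphic_on UNIV"
    "Re s > 1 \<Longrightarrow> hurwitz_zeta (of_real v) s = hz_series v s"
    by (simp_all add: P_iff)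
qed

lemma holomorphic_hz_reg: "hz_reg v holomorphic_on {s. Re s > 0}"
  unfolding hz_reg_def[abs_def] using v
  by (intro holomorphic_intros holomorphic_on_subset[OF holomorphic_hz_rem[OF v, of 1]])
     (auto simp: complex_nonpos_Reals_iff)

lemma hz_reg_eq_series: "Re s > 1 \<Longrightarrow> hz_reg v s = (s - 1) * hz_series v s"
  using hz_series_recursion[OF v, of s 1] by (simp add: hz_reg_def)

text \<open>Both sides agree for Re s > 1, and the identity theorem carries this to Re s > 0. The
  comparison is made with \<open>remove_sings\<close> of the quotient, which is nicely meromorphic
  whatever happens at 1.\<close>

lemma hurwitz_zeta_eq_hz_reg:
  assumes "Re s > 0" "s \<noteq> 1"
  shows "hurwitz_zeta (of_real v) s = hz_reg v s / (s - 1)"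
proof -
  let ?H = "{s. Re s > 0}"
  let ?f = "\<lambda>s. hz_reg v s / (s - 1)"
  have an: "?f analytic_on {s}" if "Re s > 0" "s \<noteq> 1" for s
  proof -
    have "open ({s. Re s > 0} - {1})" by (intro open_Diff open_Re_gt) auto
    moreover have "?f holomorphic_on ({s. Re s > 0} - {1})"
      by (intro holomorphic_intros holomorphic_on_subset[OF holomorphic_hz_reg]) auto
    ultimately show ?thesis using that unfolding analytic_at by blast
  qed
  have "?f meromorphic_on ?H"
    by (intro meromorphic_intros analytic_on_imp_meromorphic_on)
       (auto simp: analytic_on_open open_Re_gt holomorphic_hz_reg intro!: analytic_intros)
  hence nice: "remove_sings ?f nicely_meromorphic_on ?H"
    by (rule remove_sings_nicely_meromorphic)
  have "hurwitz_zeta (of_real v) s = remove_sings ?f s"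
  proof (rule nicely_meromorphic_on_unique[of "hurwitz_zeta (of_real v)" ?H "remove_sings ?f" 2 s])
    show "hurwitz_zeta (of_real v) nicely_meromorphic_on ?H"
      by (rule nicely_meromorphic_on_subset[OF hurwitz_zeta_properties(1)]) auto
    have "hurwitz_zeta (of_real v) w = remove_sings ?f w" if "Re w > 1" for w
    proof -
      have "?f analytic_on {w}" using that by (intro an) auto
      moreover have "w \<noteq> 1" using that by auto
      ultimately show ?thesis using hurwitz_zeta_properties(2)[OF that] hz_reg_eq_series[OF that]
        by simp
    qed
    thus "\<forall>\<^sub>F w in at 2. hurwitz_zeta (of_real v) w = remove_sings ?f w"
      using eventually_at_in_open'[OF open_Re_gt[of 1], of 2]
      by (auto elim!: eventually_mono)
  qed (use assms nice in \<open>auto simp: open_Re_gt connected_Re_gt\<close>)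
  also have "\<dots> = ?f s" using an[OF assms] by simp
  finally show ?thesis .
qed

end

section \<open>Laurent coefficients at the pole\<close>

context
  fixes v :: real
  assumes v: "v > 0"
begin

text \<open>This is the residue of zeta at 1. At s = 1 the expanded function is the constant y powr
  0, so every Taylor remainder vanishes.\<close>

lemma hz_reg_at_1: "hz_reg v 1 = 1"
proof -
  have "hz_term v 1 n 1 = 0" for n
    using v by (simp add: hz_term_def powr_def add_eq_0_iff of_real_eq_0_iff flip: of_real_add)
  hence "hz_rem v 1 1 = 0" unfolding hz_rem_def by simp
  thus ?thesis using v by (simp add: hz_reg_def)
qed

lemma stieltjes_gamma_1_eq_hz_reg:
  "stieltjes_gamma 1 (of_real v) = - deriv (deriv (hz_reg v)) 1 / 2"
proof -
  define F where "F = fps_expansion (hz_reg v) 1"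
  let ?Z = "hurwitz_zeta (of_real v)"
  have "hz_reg v analytic_on {1}"
    using holomorphic_hz_reg[OF v] open_Re_gt[of 0] unfolding analytic_at by force
  hence "(\<lambda>w. hz_reg v (1 + w)) has_fps_expansion F"
    unfolding F_def by (rule analytic_at_imp_has_fps_expansion)
  hence "(\<lambda>w. hz_reg v (1 + w)) has_laurent_expansion fps_to_fls F"
    by (rule has_laurent_expansion_fps)
  hence "(\<lambda>w. hz_reg v (1 + w) / w) has_laurent_expansion fps_to_fls F / fls_X"
    by (intro laurent_expansion_intros)
  also have "?this \<longleftrightarrow> (\<lambda>w. ?Z (1 + w)) has_laurent_expansion fps_to_fls F / fls_X"
  proof (intro has_laurent_expansion_cong refl)
    have "\<forall>\<^sub>F w in at 0. w \<in> ball 0 1 - {0 :: complex}"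
      by (intro eventually_at_in_open) auto
    thus "\<forall>\<^sub>F w in at 0. hz_reg v (1 + w) / w = ?Z (1 + w)"
    proof eventually_elim
      case (elim w)
      have "Re (1 + w) > 0" using elim abs_Re_le_cmod[of w] by auto
      thus ?case using elim hurwitz_zeta_eq_hz_reg[OF v, of "1 + w"] by simp
    qed
  qed
  finally have Z: "(\<lambda>w. ?Z (1 + w)) has_laurent_expansion fps_to_fls F / fls_X" .
  have "laurent_expansion ?Z 1 = fps_to_fls F / fls_X"
    by (rule has_laurent_expansion_unique[OF _ Z], rule not_essential_has_laurent_expansion)
       (use hurwitz_zeta_properties(1)[OF v] in
          \<open>auto simp: nicely_meromorphic_on_def intro: meromorphic_on_isolated_singularity
             meromorphic_on_not_essential meromorphic_on_subset\<close>)
  also have "fps_to_fls F / fls_X = fls_shift 1 (fps_to_fls F)"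
    by (simp add: fls_X_inv_times_conv_shift(1) fls_divide_X)
  \<comment> \<open>Division by s - 1 shifts indices by one, so the coefficient of (s - 1) in zeta
    is the Taylor coefficient of order 2 of \<open>hz_reg\<close>; the sign is (-1) ^ 1.\<close>
  finally have "stieltjes_gamma 1 (of_real v) = - fps_nth F 2"
    by (simp add: stieltjes_gamma_def)
  thus ?thesis by (simp add: F_def fps_expansion_def numeral_2_eq_2)
qed

end

text \<open>Termwise differentiation at s = 1 gives 1 / (n + 1) - (ln (n + 2) - ln (n + 1)), the
  classical series for Euler's constant. This is the Laurent coefficient gamma_0(1).\<close>

lemma deriv_hz_reg_1_at_1: "deriv (hz_reg 1) 1 = euler_mascheroni"
proof -
  have der: "deriv (hz_term 1 1 n) 1 =
       inverse (of_nat (n+1)) + of_real (ln (of_nat (n+1))) - of_real (ln (of_nat (n+2)))" for n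
  proof -
    have *: "hz_term 1 1 n = (\<lambda>s. of_real (real n + 2) powr (1 - s) - of_real (real n + 1) powr (1 - s)
       - (1 - s) * of_real (real n + 1) powr (- s))"
      by (simp add: hz_term_def fun_eq_iff algebra_simps)
    have "(hz_term 1 1 n has_field_derivative (inverse (of_real (real n + 1)) +
       Ln (of_real (real n + 1)) - Ln (of_real (real n + 2)))) (at 1)"
    proof -
      have D: "((\<lambda>s. b powr (1 - s) - a powr (1 - s) - (1 - s) * a powr (- s)) has_field_derivative
         (inverse a + Ln a - Ln b)) (at 1)" if "a \<noteq> 0" "b \<noteq> 0" for a b :: complex
      proof -
        have E: "((\<lambda>s. c powr (1 - s)) has_field_derivative (- Ln c)) (at 1)" if "c \<noteq> 0" for c
          using that unfolding powr_def by (auto intro!: derivative_eq_intros)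
        have "((\<lambda>s. (1 - s) * a powr (- s)) has_field_derivative (- inverse a)) (at 1)"
          using that unfolding powr_def by (auto intro!: derivative_eq_intros simp: exp_minus)
        from DERIV_diff[OF DERIV_diff[OF E[OF that(2)] E[OF that(1)]] this] show ?thesis by (simp add: algebra_simps)
      qed
      show ?thesis unfolding * by (rule D; unfold of_real_eq_0_iff; linarith)
    qed
    hence "deriv (hz_term 1 1 n) 1 = inverse (of_real (real n + 1)) +
       Ln (of_real (real n + 1)) - Ln (of_real (real n + 2))" by (rule DERIV_imp_deriv)
    also have "\<dots> = inverse (of_nat (n+1)) + of_real (ln (of_nat (n+1))) - of_real (ln (of_nat (n+2)))"
    proof -
      have L: "Ln (of_real (real n + c)) = of_real (ln (real n + c))" if "c > 0" for c
        by (rule Ln_of_real) (use that in auto)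
      show ?thesis unfolding L[OF zero_less_one] L[OF zero_less_numeral] by (simp add: add_ac)
    qed
    finally show ?thesis .
  qed
  have "(\<lambda>n. deriv (hz_term 1 1 n) 1) sums deriv (hz_rem 1 1) 1"
    by (rule deriv_hz_rem_sums) auto
  hence "deriv (hz_rem 1 1) 1 = euler_mascheroni"
    unfolding der using euler_mascheroni_sum sums_unique2 by blast
  moreover have "hz_reg 1 = (\<lambda>s. 1 + hz_rem 1 1 s)"
    by (simp add: hz_reg_def fun_eq_iff)
  moreover have "hz_rem 1 1 field_differentiable at 1"
    using holomorphic_hz_rem[of 1 1] open_Re_gt[of 0]
    by (auto intro!: holomorphic_on_imp_differentiable_at)
  ultimately show ?thesis by simp
qed

text \<open>For Re s > 1, group the integers k + 1 by their residue modulo m. The point s = 1 lies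
  outside that region, so the identity is continued analytically to Re s > 0.\<close>

lemma hz_reg_distribution:
  assumes m: "m > 0" and s: "Re s > 0"
  shows "(\<Sum>r=1..m. hz_reg (real r / real m) s) = of_nat m powr s * hz_reg 1 s"
proof -
  have pos: "real r / real m > 0" if "r \<in> {1..m}" for r using that m by auto
  have *: "(\<Sum>r=1..m. hz_reg (real r / real m) s) = of_nat m powr s * hz_reg 1 s" if s: "Re s > 1" for s
  proof -
    have "(\<lambda>n. \<Sum>r=1..m. of_real (real n + real r / real m) powr (- s)) sums
            (\<Sum>r=1..m. hz_series (real r / real m) s)"
      by (intro sums_sum hz_series_sums pos s)
    moreover have "(\<lambda>n. of_nat m powr s * (\<Sum>k=n*m..<n*m+m. of_real (real k + 1) powr (- s))) sums
            (of_nat m powr s * hz_series 1 s)"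
      by (intro sums_mult sums_group hz_series_sums m s) auto
    moreover have "of_nat m powr s * (\<Sum>k=n*m..<n*m+m. of_real (real k + 1) powr (- s)) =
       (\<Sum>r=1..m. of_real (real n + real r / real m) powr (- s))" for n
    proof -
      have "(\<Sum>k=n*m..<n*m+m. complex_of_real (real k + 1) powr (- s)) =
            (\<Sum>r=1..m. of_real (real (n*m+r)) powr (- s))"
        \<comment> \<open>The series at v = 1 runs over k + 1, so the block n m <= k < n m + m
          corresponds to k + 1 = n m + r with r from 1 to m, the residue 0 being represented by r =
          m.\<close>
        by (rule sum.reindex_bij_witness[of _ "\<lambda>r. n*m+r-1" "\<lambda>k. k+1-n*m"]) (auto simp: algebra_simps)
      also have "of_nat m powr s * \<dots> = (\<Sum>r=1..m. of_real (real n + real r / real m) powr (- s))"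
        unfolding sum_distrib_left
      proof (intro sum.cong refl)
        fix r assume r: "r \<in> {1..m}"
        have "real (n*m+r) = real m * (real n + real r / real m)" using m by (simp add: field_simps)
        hence "complex_of_real (real (n*m+r)) powr (- s) =
            of_real (real m) powr (- s) * of_real (real n + real r / real m) powr (- s)"
          by (simp only: of_real_mult) (rule powr_times_real, auto)
        thus "of_nat m powr s * of_real (real (n*m+r)) powr (- s) =
           of_real (real n + real r / real m) powr (- s)" using m by (simp add: powr_minus)
      qed
      finally show ?thesis .
    qed
    ultimately have "(\<Sum>r=1..m. hz_series (real r / real m) s) = of_nat m powr s * hz_series 1 s"
      using sums_unique2 by simp
    moreover have "(\<Sum>r=1..m. hz_reg (real r / real m) s) = (s - 1) * (\<Sum>r=1..m. hz_series (real r / real m) s)"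
      unfolding sum_distrib_left by (intro sum.cong refl hz_reg_eq_series pos s)
    ultimately show ?thesis using s by (simp add: hz_reg_eq_series)
  qed
  show ?thesis
  proof (rule analytic_continuation_open[of "{s. Re s > 1}" "{s. Re s > 0}"
            "\<lambda>s. \<Sum>r=1..m. hz_reg (real r / real m) s" "\<lambda>s. of_nat m powr s * hz_reg 1 s"])
    show "{s. 1 < Re s} \<noteq> {}" by (auto intro: exI[of _ 2])
    show "(\<lambda>s. \<Sum>r=1..m. hz_reg (real r / real m) s) holomorphic_on {s. 0 < Re s}"
      by (intro holomorphic_intros holomorphic_hz_reg pos)
    show "(\<lambda>s. of_nat m powr s * hz_reg 1 s) holomorphic_on {s. 0 < Re s}"
      using m by (intro holomorphic_intros holomorphic_hz_reg) auto
  qed (use * s in \<open>auto simp: open_Re_gt connected_Re_gt\<close>)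
qed

text \<open>Leibniz' rule for m powr s times E(s, 1), with E(1, 1) = 1 and E'(1, 1) equal to Euler's
  constant. These values produce the terms in ln m and its square.\<close>

lemma deriv2_hz_reg_distribution:
  assumes m: "m > 0"
  shows "(\<Sum>r=1..m. deriv (deriv (hz_reg (real r / real m))) 1) =
           of_nat m * (of_real ((ln m)\<^sup>2) + 2 * of_real (ln m) * euler_mascheroni + deriv (deriv (hz_reg 1)) 1)"
proof -
  let ?H = "{s. Re s > 0}"
  have d1: "(hz_reg v has_field_derivative deriv (hz_reg v) s) (at s)" if "v > 0" "s \<in> ?H" for v s
    by (rule holomorphic_derivI[OF holomorphic_hz_reg open_Re_gt]) (use that in auto)
  have d2: "(deriv (hz_reg v) has_field_derivative deriv (deriv (hz_reg v)) s) (at s)" if "v > 0" "s \<in> ?H" for v s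
    by (rule holomorphic_derivI[OF holomorphic_deriv[OF holomorphic_hz_reg] open_Re_gt])
       (use that open_Re_gt in auto)
  have pos: "real r / real m > 0" if "r \<in> {1..m}" for r using that m by auto
  let ?L = "complex_of_real (ln (real m))"
  have Lm: "Ln (of_nat m) = ?L" using m Ln_of_nat by simp
  have eq1: "(\<Sum>r=1..m. deriv (hz_reg (real r / real m)) s) =
      of_nat m powr s * (?L * hz_reg 1 s + deriv (hz_reg 1) s)" if s: "s \<in> ?H" for s
  proof -
    have "((\<lambda>s. of_nat m powr s * hz_reg 1 s) has_field_derivative
       (\<Sum>r=1..m. deriv (hz_reg (real r / real m)) s)) (at s)"
      by (rule has_field_derivative_transform_within_open[OF DERIV_sum[OF d1[OF pos s]] open_Re_gt s])
         (use hz_reg_distribution[OF m] in auto)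
    moreover have "((\<lambda>s. of_nat m powr s * hz_reg 1 s) has_field_derivative
       of_nat m powr s * (?L * hz_reg 1 s + deriv (hz_reg 1) s)) (at s)"
      using m s by (auto intro!: derivative_eq_intros d1 simp: Lm algebra_simps)
    ultimately show ?thesis by (rule DERIV_unique)
  qed
  have one: "1 \<in> ?H" by simp
  have "((\<lambda>s. of_nat m powr s * (?L * hz_reg 1 s + deriv (hz_reg 1) s)) has_field_derivative
     (\<Sum>r=1..m. deriv (deriv (hz_reg (real r / real m))) 1)) (at 1)"
    by (rule has_field_derivative_transform_within_open[OF DERIV_sum[OF d2[OF pos one]] open_Re_gt one])
       (use eq1 in auto)
  moreover have "((\<lambda>s. of_nat m powr s * (?L * hz_reg 1 s + deriv (hz_reg 1) s)) has_field_derivative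
     of_nat m powr 1 * ?L * (?L * hz_reg 1 1 + deriv (hz_reg 1) 1)
       + of_nat m powr 1 * (?L * deriv (hz_reg 1) 1 + deriv (deriv (hz_reg 1)) 1)) (at 1)"
    using m by (auto intro!: derivative_eq_intros d1 d2 simp: Lm algebra_simps)
  ultimately have "(\<Sum>r=1..m. deriv (deriv (hz_reg (real r / real m))) 1) =
     of_nat m powr 1 * ?L * (?L * hz_reg 1 1 + deriv (hz_reg 1) 1)
       + of_nat m powr 1 * (?L * deriv (hz_reg 1) 1 + deriv (deriv (hz_reg 1)) 1)"
    by (rule DERIV_unique)
  thus ?thesis using m by (simp add: hz_reg_at_1 deriv_hz_reg_1_at_1 algebra_simps power2_eq_square)
qed

section \<open>The odd part of the Hurwitz zeta function\<close>

text \<open>The mean value theorem without an order between a and b, since it is applied to k + v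
  and k + 1 - v, either of which may be the larger.\<close>

lemma powr_diff_mvt:
  fixes a b p :: real
  assumes "a > 0" "b > 0"
  obtains c where "min a b \<le> c" "c \<le> max a b" "b powr p - a powr p = p * (b - a) * c powr (p - 1)"
proof -
  have main: "\<exists>c. a \<le> c \<and> c \<le> b \<and> b powr p - a powr p = p * (b - a) * c powr (p - 1)"
    if "0 < a" "a < b" for a b :: real
  proof -
    have "\<exists>z>a. z < b \<and> b powr p - a powr p = (b - a) * (p * z powr (p - 1))"
    proof (rule MVT2)
      show "((\<lambda>x. x powr p) has_real_derivative p * z powr (p - 1)) (at z)" if "a \<le> z" "z \<le> b" for z
        using that \<open>0 < a\<close> by (auto intro!: derivative_eq_intros simp: powr_diff)
    qed fact
    then obtain z where "a < z" "z < b" "b powr p - a powr p = (b - a) * (p * z powr (p - 1))" by blast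
    thus ?thesis by (intro exI[of _ z]) (simp add: mult_ac)
  qed
  consider "a < b" | "b < a" | "a = b" by linarith
  thus ?thesis
  proof cases
    case 1
    from main[OF assms(1) 1] show ?thesis using 1 by (auto intro: that)
  next
    case 2
    from main[OF assms(2) 2] obtain c where "b \<le> c" "c \<le> a"
      "a powr p - b powr p = p * (a - b) * c powr (p - 1)" by blast
    thus ?thesis using 2 by (intro that[of c]) (auto simp: algebra_simps)
  next
    case 3
    thus ?thesis by (intro that[of a]) auto
  qed
qed

text \<open>The function W_v of the overview, for real arguments only. Pairing the terms is
  essential for s <= 1, where neither half converges by itself.\<close>

definition odd_hz :: "real \<Rightarrow> real \<Rightarrow> real" where
  "odd_hz v s = (\<Sum>k. (real k + v) powr (-s) - (real k + 1 - v) powr (-s))"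

context
  fixes v :: real
  assumes v: "v > 0" "v < 1"
begin

text \<open>Subtracting the first-order Taylor terms for v and 1 - v leaves (s - 1) times the
  summand of \<open>odd_hz\<close> plus the telescoping difference \<open>d (Suc n) - d n\<close>.
  Convergence of \<open>odd_hz\<close> is therefore inherited from that of the two
  remainders.\<close>

lemma
  assumes s: "0 < s" "s < 1"
  shows odd_hz_sums: "(\<lambda>k. (real k + v) powr (-s) - (real k + 1 - v) powr (-s)) sums odd_hz v s"
    and hz_reg_diff_eq_odd_hz:
      "hz_reg v (of_real s) - hz_reg (1 - v) (of_real s) = of_real ((s - 1) * odd_hz v s)"
proof -
  define c where "c = (\<lambda>k. (real k + v) powr (-s) - (real k + 1 - v) powr (-s))"
  define d where "d = (\<lambda>k. (real k + v) powr (1-s) - (real k + 1 - v) powr (1-s))"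
  \<comment> \<open>Both powers grow, but by the mean value theorem their difference is O(k powr
    (-s)).\<close>
  have "d \<longlonglongrightarrow> 0"
  proof (rule Lim_null_comparison)
    show "(\<lambda>k. real k powr (-s)) \<longlonglongrightarrow> 0"
      using s by (intro tendsto_neg_powr filterlim_real_sequentially) auto
    show "\<forall>\<^sub>F k in sequentially. norm (d k) \<le> real k powr (-s)"
      using eventually_gt_at_top[of 0]
    proof eventually_elim
      case (elim k)
      obtain \<xi> where \<xi>: "min (real k + 1 - v) (real k + v) \<le> \<xi>"
        "d k = (1 - s) * (2 * v - 1) * \<xi> powr (- s)"
        using powr_diff_mvt[of "real k + 1 - v" "real k + v" "1 - s"] v elim
        by (auto simp: d_def algebra_simps)
      have "\<xi> powr (-s) \<le> real k powr (-s)" using \<xi>(1) v s elim by (intro powr_mono2') auto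
      moreover have "\<bar>(1 - s) * (2 * v - 1)\<bar> \<le> 1 * 1"
        unfolding abs_mult using s v by (intro mult_mono) auto
      ultimately have "\<bar>(1 - s) * (2 * v - 1)\<bar> * \<xi> powr (-s) \<le> 1 * real k powr (-s)"
        by (intro mult_mono) auto
      thus ?case by (simp add: \<xi>(2) abs_mult)
    qed
  qed
  from telescope_sums[OF this]
  have "(\<lambda>n. complex_of_real (d (Suc n) - d n)) sums of_real (- d 0)"
    by (subst sums_of_real_iff) simp
  moreover have "(\<lambda>n. hz_term v 1 n (of_real s)) sums hz_rem v 1 (of_real s)"
    "(\<lambda>n. hz_term (1-v) 1 n (of_real s)) sums hz_rem (1-v) 1 (of_real s)"
    using s v by (auto intro!: hz_rem_sums)
  ultimately have "(\<lambda>n. hz_term v 1 n (of_real s) - hz_term (1-v) 1 n (of_real s) - of_real (d (Suc n) - d n))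
     sums (hz_rem v 1 (of_real s) - hz_rem (1-v) 1 (of_real s) - of_real (- d 0))"
    by (intro sums_diff)
  also have "(\<lambda>n. hz_term v 1 n (of_real s) - hz_term (1-v) 1 n (of_real s) - of_real (d (Suc n) - d n)) =
     (\<lambda>n. of_real ((s - 1) * c n))"
  proof
    fix n
    have P: "complex_of_real x powr (1 - of_real s) = of_real (x powr (1 - s))"
            "complex_of_real x powr (- of_real s) = of_real (x powr (- s))" if "x > 0" for x
      using that powr_of_real[of x "1 - s"] powr_of_real[of x "-s"] by auto
    have H: "hz_term u 1 n (of_real s) = of_real ((real n + u + 1) powr (1 - s) - (real n + u) powr (1 - s)
         - (1 - s) * (real n + u) powr (- s))" if "u > 0" for u
      unfolding hz_term_def using that P[of "real n + u"] P[of "real n + u + 1"]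
      by simp
    have e: "real (Suc n) + v = real n + v + 1" "real (Suc n) + 1 - v = real n + (1 - v) + 1"
       "real n + 1 - v = real n + (1 - v)" by auto
    show "hz_term v 1 n (of_real s) - hz_term (1-v) 1 n (of_real s) - of_real (d (Suc n) - d n) =
      of_real ((s - 1) * c n)"
      using v H[of v] H[of "1 - v"] by (simp only: d_def c_def e of_real_diff [symmetric] of_real_eq_iff diff_gt_0_iff_gt) (simp add: algebra_simps)
  qed
  \<comment> \<open>The boundary value \<open>d 0\<close> of the telescoping sum is exactly the
    difference of the initial powers contained in \<open>hz_reg\<close>.\<close>
  also have "hz_rem v 1 (of_real s) - hz_rem (1-v) 1 (of_real s) - of_real (- d 0) =
     hz_reg v (of_real s) - hz_reg (1 - v) (of_real s)"
    using v powr_of_real[of v "1 - s"] powr_of_real[of "1 - v" "1 - s"]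
    by (simp add: hz_reg_def d_def)
  finally have sums: "(\<lambda>n. of_real ((s - 1) * c n)) sums (hz_reg v (of_real s) - hz_reg (1 - v) (of_real s))" .
  hence "summable (\<lambda>n. Re (complex_of_real ((s - 1) * c n)))"
    by (intro summable_Re) (auto simp: sums_iff)
  hence "summable c" using s by (simp add: summable_cmult_iff)
  thus c: "c sums odd_hz v s" unfolding odd_hz_def c_def by (rule summable_sums)
  have "(\<lambda>n. complex_of_real ((s - 1) * c n)) sums of_real ((s - 1) * odd_hz v s)"
    by (subst sums_of_real_iff) (intro sums_mult c)
  with sums show "hz_reg v (of_real s) - hz_reg (1 - v) (of_real s) = of_real ((s - 1) * odd_hz v s)"
    by (rule sums_unique2)
qed

text \<open>Passing to w = 0 termwise in \<open>odd_hz\<close> fails: every term tends to 0, the sum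
  to 1 - 2 v. Subtracting 1 - 2 v times a telescoping series of sum 1 with the same leading
  behaviour makes the terms O(w k powr (-2)). Tannery's theorem then applies to the quotients by w,
  and the limiting series is a difference of two Euler-Gauss limits for ln Gamma.\<close>

lemma odd_hz_diff_quotient_tendsto:
  "((\<lambda>w. (odd_hz v w - (1 - 2 * v)) / w) \<longlongrightarrow> ln_Gamma v - ln_Gamma (1 - v)) (at_right 0)"
proof -
  define a where "a = (\<lambda>(k::nat) w. (((real k + v) powr (-w) - (real k + 1 - v) powr (-w))
     - (1 - 2 * v) * ((real k + 1) powr (-w) - (real k + 2) powr (-w))) / w)"
  define b where "b = (\<lambda>k::nat. ln (real k + 1 - v) - ln (real k + v)
     - (1 - 2 * v) * (ln (real k + 2) - ln (real k + 1)))"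
  have lim: "((\<lambda>w. a k w) \<longlongrightarrow> b k) (at_right 0)" for k
  proof -
    have D: "((\<lambda>w. (y powr (-w) - z powr (-w)) / w) \<longlongrightarrow> ln z - ln y) (at_right 0)" if "y > 0" "z > 0" for y z :: real
    proof -
      have "((\<lambda>w. y powr (-w) - z powr (-w)) has_real_derivative (ln z - ln y)) (at 0 within {0<..})"
        using that unfolding powr_def by (auto intro!: derivative_eq_intros)
      thus ?thesis using that by (simp add: has_field_derivative_iff)
    qed
    have "((\<lambda>w. ((real k + v) powr (-w) - (real k + 1 - v) powr (-w)) / w
       - (1 - 2 * v) * (((real k + 1) powr (-w) - (real k + 2) powr (-w)) / w)) \<longlongrightarrow> b k) (at_right 0)"
      unfolding b_def using v by (intro tendsto_intros D) auto
    thus ?thesis by (simp add: a_def diff_divide_distrib right_diff_distrib)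
  qed
  \<comment> \<open>One mean value step for each of the two differences, then one between the
    intermediate points in [k, k + 1] and [k + 1, k + 2]. The constant 4 bounds (w + 1) times the
    distance of these points.\<close>
  have bound: "norm (a k w) \<le> 4 * real k powr (-2)" if "k \<ge> 1" "0 < w" "w < 1" for k w
  proof -
    have k: "real k > 0" using that by auto
    have "0 < real k + 1 - v" "0 < real k + v" using k v by auto
    then obtain \<xi> where x: "min (real k + 1 - v) (real k + v) \<le> \<xi>" "\<xi> \<le> max (real k + 1 - v) (real k + v)"
      "(real k + v) powr (-w) - (real k + 1 - v) powr (-w) = - w * (real k + v - (real k + 1 - v)) * \<xi> powr (-w-1)"
      by (rule powr_diff_mvt)
    have \<xi>: "real k \<le> \<xi>" "\<xi> \<le> real k + 1" using x(1,2) v by linarith+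
    have x': "(real k + v) powr (-w) - (real k + 1 - v) powr (-w) = w * ((1 - 2 * v) * \<xi> powr (-w-1))"
      unfolding x(3) by (simp add: algebra_simps)
    have "0 < real k + 2" "0 < real k + 1" by auto
    then obtain \<eta> where e: "min (real k + 2) (real k + 1) \<le> \<eta>" "\<eta> \<le> max (real k + 2) (real k + 1)"
      "(real k + 1) powr (-w) - (real k + 2) powr (-w) = - w * (real k + 1 - (real k + 2)) * \<eta> powr (-w-1)"
      by (rule powr_diff_mvt)
    have \<eta>: "real k + 1 \<le> \<eta>" "\<eta> \<le> real k + 2" using e(1,2) by linarith+
    have e': "(real k + 1) powr (-w) - (real k + 2) powr (-w) = w * \<eta> powr (-w-1)"
      unfolding e(3) by simp
    have "a k w = (1 - 2 * v) * (\<xi> powr (-w-1) - \<eta> powr (-w-1))"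
      unfolding a_def x' e' using that by (simp add: field_simps)
    moreover have "0 < \<eta>" "0 < \<xi>" using \<xi> \<eta> k by linarith+
    then obtain \<zeta> where z: "min \<eta> \<xi> \<le> \<zeta>" "\<zeta> \<le> max \<eta> \<xi>"
      "\<xi> powr (-w-1) - \<eta> powr (-w-1) = (-w-1) * (\<xi> - \<eta>) * \<zeta> powr (-w-1-1)"
      by (rule powr_diff_mvt)
    moreover have \<zeta>: "\<xi> \<le> \<zeta>" using z(1) \<xi> \<eta> by linarith
    moreover have "(-w-1) * (\<xi> - \<eta>) = (w+1) * (\<eta> - \<xi>)" by (simp add: algebra_simps)
    moreover have "0 \<le> w + 1" "0 \<le> \<eta> - \<xi>" using \<xi> \<eta> that by auto
    ultimately have "norm (a k w) = \<bar>1 - 2 * v\<bar> * ((w+1) * (\<eta> - \<xi>) * \<zeta> powr (-w-1-1))"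
      by (simp only: real_norm_def abs_mult abs_of_nonneg powr_ge_zero)
    also have "\<dots> \<le> 1 * ((2 * 2) * real k powr (-2))"
    proof (intro mult_mono)
      have "\<zeta> powr (-w-1-1) \<le> real k powr (-w-1-1)" using \<zeta> \<xi> that by (intro powr_mono2') auto
      also have "\<dots> \<le> real k powr (-2)" using that by (intro powr_mono) auto
      finally show "\<zeta> powr (-w-1-1) \<le> real k powr (-2)" .
    qed (use v that \<xi> \<eta> in auto)
    finally show ?thesis by simp
  qed
  have "((\<lambda>w. suminf (\<lambda>k. a k w)) \<longlongrightarrow> suminf b) (at_right 0)"
  proof (rule tannerys_theorem[THEN conjunct2, THEN conjunct2])
    show "\<forall>\<^sub>F (k, w) in sequentially \<times>\<^sub>F at_right 0. norm (a k w) \<le> 4 * real k powr (-2)"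
    proof -
      have "\<forall>\<^sub>F w in at_right (0::real). w \<in> {0<..<1}"
        by (rule eventually_at_right_real) auto
      from eventually_prodI[OF eventually_ge_at_top[of "1::nat"] this] show ?thesis
        by (rule eventually_mono) (auto simp del: real_norm_def intro!: bound)
    qed
    show "summable (\<lambda>k. 4 * real k powr (-2))" by (simp add: summable_real_powr_iff)
  qed (use lim in auto)
  moreover have "\<forall>\<^sub>F w in at_right 0. suminf (\<lambda>k. a k w) = (odd_hz v w - (1 - 2 * v)) / w"
  proof -
    have "\<forall>\<^sub>F w in at_right (0::real). w \<in> {0<..<1}"
      by (rule eventually_at_right_real) auto
    thus ?thesis
    proof eventually_elim
      case (elim w)
      have "(\<lambda>k. (real k + 1) powr (-w)) \<longlonglongrightarrow> 0"
        using elim by (intro tendsto_neg_powr) (auto, real_asymp)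
      from telescope_sums'[OF this]
      have t: "(\<lambda>k. (real k + 1) powr (-w) - (real k + 2) powr (-w)) sums 1" by (simp add: add_ac)
      have "(\<lambda>k. a k w) sums ((odd_hz v w - (1 - 2 * v) * 1) / w)"
        unfolding a_def using elim by (intro sums_divide sums_diff sums_mult t odd_hz_sums) auto
      thus ?case by (simp add: sums_iff)
    qed
  qed
  ultimately have main: "((\<lambda>w. (odd_hz v w - (1 - 2 * v)) / w) \<longlongrightarrow> suminf b) (at_right 0)"
    by (rule Lim_transform_eventually)
  have "suminf b = ln_Gamma v - ln_Gamma (1 - v)"
  proof -
    \<comment> \<open>In the Euler-Gauss approximations the sums of ln k cancel and (2 v - 1) ln n
      remains; the telescoped correction contributes ln (n + 2) instead, so the discrepancy tends to
      0.\<close>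
    have sumb: "(\<Sum>k<Suc n. b k) = ln_Gamma_series v n - ln_Gamma_series (1 - v) n
        - (1 - 2 * v) * (ln (real n + 2) - ln (real n))" if "n > 0" for n
    proof -
      have S: "ln_Gamma_series u n = u * ln n - (\<Sum>k<Suc n. ln (real k + u)) + (\<Sum>k=1..n. ln (real k))" if "u > 0" for u
      proof -
        have "ln (u / real k + 1) = ln (real k + u) - ln (real k)" if "k \<in> {1..n}" for k
        proof -
          have "u / real k + 1 = (real k + u) / real k" using that by (simp add: field_simps)
          also have "ln \<dots> = ln (real k + u) - ln (real k)"
            using that \<open>u > 0\<close> by (intro ln_divide_pos) auto
          finally show ?thesis .
        qed
        hence "(\<Sum>k=1..n. ln (u / real k + 1)) = (\<Sum>k=1..n. ln (real k + u)) - (\<Sum>k=1..n. ln (real k))"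
          by (simp add: sum_subtractf)
        moreover have "(\<Sum>k<Suc n. ln (real k + u)) = ln u + (\<Sum>k=1..n. ln (real k + u))"
          by (subst sum.lessThan_Suc_shift) (simp add: sum.atLeast1_atMost_eq)
        ultimately show ?thesis unfolding ln_Gamma_series_def by simp
      qed
      have T: "(\<Sum>k<Suc n. ln (real k + 2) - ln (real k + 1)) = ln (real n + 2)"
        using sum_lessThan_telescope[of "\<lambda>k. ln (real k + 1)" "Suc n"] by (simp add: add_ac)
      have "(\<Sum>k<Suc n. b k) = (\<Sum>k<Suc n. ln (real k + 1 - v)) - (\<Sum>k<Suc n. ln (real k + v))
        - (1 - 2 * v) * (\<Sum>k<Suc n. ln (real k + 2) - ln (real k + 1))"
        by (simp only: b_def sum_subtractf sum_distrib_left [symmetric])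
      also have "(\<Sum>k<Suc n. ln (real k + 1 - v)) = (\<Sum>k<Suc n. ln (real k + (1 - v)))"
        by (simp add: algebra_simps)
      finally show ?thesis unfolding T S[OF v(1)] using S[of "1 - v"] v by (simp add: algebra_simps)
    qed
    have "(\<lambda>n. ln_Gamma_series v n - ln_Gamma_series (1 - v) n
        - (1 - 2 * v) * (ln (real n + 2) - ln (real n))) \<longlonglongrightarrow> ln_Gamma v - ln_Gamma (1 - v) - (1 - 2 * v) * 0" (is "?S \<longlonglongrightarrow> _")
    proof (intro tendsto_intros ln_Gamma_real_LIMSEQ)
      show "(\<lambda>n. ln (real n + 2) - ln (real n)) \<longlonglongrightarrow> 0" by real_asymp
    qed (use v in auto)
    moreover have "\<forall>\<^sub>F n in sequentially. ?S n = (\<Sum>k<Suc n. b k)"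
      using eventually_gt_at_top[of 0] by eventually_elim (rule sumb[symmetric])
    ultimately have "(\<lambda>n. \<Sum>k<Suc n. b k) \<longlonglongrightarrow> ln_Gamma v - ln_Gamma (1 - v)"
      using Lim_transform_eventually by fastforce
    hence "b sums (ln_Gamma v - ln_Gamma (1 - v))"
      unfolding sums_def by (rule LIMSEQ_imp_Suc)
    thus ?thesis by (simp add: sums_iff)
  qed
  with main show ?thesis by simp
qed

end

section \<open>Mellin kernels and partial fractions\<close>

text \<open>Change of variables yields absolute integrability and a gauge integral, whereas termwise
  integration is done with Bochner integrals.\<close>

lemma has_bochner_integral_lebesgue_onI:
  fixes f :: "real \<Rightarrow> real"
  assumes "f absolutely_integrable_on S \<and> integral S f = b" "S \<in> sets lebesgue"
  shows "has_bochner_integral (lebesgue_on S) f b"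
  using assms lebesgue_integral_eq_integral[of S f]
  by (auto simp: has_bochner_integral_iff absolutely_integrable_imp_integrable)

lemma Gamma_integral_scaled:
  fixes s a :: real
  assumes s: "s > 0" and a: "a > 0"
  shows "has_bochner_integral (lebesgue_on {0<..}) (\<lambda>u. u powr (s - 1) * exp (- a * u)) (Gamma s * a powr (-s))"
proof (rule has_bochner_integral_lebesgue_onI)
  define f where "f = (\<lambda>u. u powr (s - 1) * exp (- a * u))"
  have G: "((\<lambda>t. t powr (s - 1) / exp t) has_integral Gamma s) {0<..}"
    using Gamma_integral_real[OF s]
    by (subst has_integral_spike_set_eq[of _ "{0..}"]) (auto intro: negligible_subset[of "{0}"])
  have img: "(\<lambda>t. t / a) ` {0<..} = {0<..}"
  proof (intro equalityI subsetI)
    fix x :: real assume "x \<in> {0<..}"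
    thus "x \<in> (\<lambda>t. t / a) ` {0<..}" using a by (intro image_eqI[of _ _ "x * a"]) auto
  qed (use a in auto)
  have eq: "\<bar>1 / a\<bar> * f (t / a) = a powr (-s) * (t powr (s - 1) / exp t)" if "t > 0" for t
    using that a by (simp add: f_def powr_divide powr_diff powr_minus exp_minus field_simps)
  have "(\<lambda>t. \<bar>1 / a\<bar> * f (t / a)) absolutely_integrable_on {0<..} \<and>
     integral {0<..} (\<lambda>t. \<bar>1 / a\<bar> * f (t / a)) = Gamma s * a powr (-s)"
  proof -
    have "((\<lambda>t. \<bar>1 / a\<bar> * f (t / a)) has_integral a powr (-s) * Gamma s) {0<..}"
      by (rule has_integral_eq[OF _ has_integral_mult_right[OF G]]) (simp only: greaterThan_iff eq)
    moreover have "\<bar>1 / a\<bar> * f (t / a) \<ge> 0" for t by (simp add: f_def)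
    ultimately show ?thesis
      by (subst absolutely_integrable_on_iff_nonneg) (auto simp: has_integral_iff mult_ac)
  qed
  also have "?this \<longleftrightarrow> f absolutely_integrable_on ((\<lambda>t. t / a) ` {0<..}) \<and>
      integral ((\<lambda>t. t / a) ` {0<..}) f = Gamma s * a powr (-s)"
    using a by (intro has_absolute_integral_change_of_variables_1')
       (auto intro!: derivative_eq_intros simp: inj_on_def)
  finally show "(\<lambda>u. u powr (s - 1) * exp (- a * u)) absolutely_integrable_on {0<..} \<and>
     integral {0<..} (\<lambda>u. u powr (s - 1) * exp (- a * u)) = Gamma s * a powr (-s)"
    unfolding img f_def .
qed auto

lemma Gamma_reflection_real:
  fixes x :: real
  shows "Gamma x * Gamma (1 - x) = pi / sin (pi * x)"
proof -
  have 2: "sin (of_real pi * complex_of_real x) = of_real (sin (pi * x))"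
    using sin_of_real[of "pi * x", where 'a = complex] by simp
  have "complex_of_real (Gamma x * Gamma (1 - x)) = of_real (pi / sin (pi * x))"
    unfolding of_real_mult of_real_divide 2 [symmetric] Gamma_complex_of_real [symmetric] of_real_diff of_real_1
    by (rule Gamma_reflection_complex)
  thus ?thesis by (simp only: of_real_eq_iff)
qed

text \<open>The substitution t = u^2 / (u^2 + a^2) turns the integral into half of Beta (s/2) (1 -
  s/2), up to a power of a, and the reflection formula evaluates it. The map \<open>g\<close> is the
  inverse of this substitution.\<close>

lemma Poisson_kernel_integral:
  fixes s a :: real
  assumes s: "0 < s" "s < 2" and a: "a > 0"
  shows "has_bochner_integral (lebesgue_on {0<..}) (\<lambda>u. u powr (s - 1) * (a / (u\<^sup>2 + a\<^sup>2)))
           (a powr (s - 1) * (pi / (2 * sin (pi * s / 2))))"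
proof (rule has_bochner_integral_lebesgue_onI)
  define f where "f = (\<lambda>u. u powr (s - 1) * (a / (u\<^sup>2 + a\<^sup>2)))"
  define g where "g = (\<lambda>t. a * sqrt (t / (1 - t)))"
  define g' where "g' = (\<lambda>t::real. a * (inverse (sqrt (t / (1 - t))) / 2 * (1 / (1 - t)\<^sup>2)))"
  define I where "I = a powr (s - 1) * (pi / (2 * sin (pi * s / 2)))"
  have B: "((\<lambda>t. t powr (s/2 - 1) * (1 - t) powr ((1 - s/2) - 1)) has_integral Beta (s/2) (1 - s/2)) {0<..<1}"
    using s has_integral_Beta_real[of "s/2" "1 - s/2"] by (simp add: has_integral_Icc_iff_Ioo)
  have img: "g ` {0<..<1} = {0<..}"
  proof (intro equalityI subsetI)
    fix x assume x: "x \<in> {0::real<..}"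
    have 1: "1 + (x/a)\<^sup>2 > 0" by (rule add_pos_nonneg) auto
    have "(x/a)\<^sup>2 / (1 + (x/a)\<^sup>2) / (1 - (x/a)\<^sup>2 / (1 + (x/a)\<^sup>2)) = (x/a)\<^sup>2"
      using 1 by (simp add: divide_simps)
    hence "x = g ((x/a)\<^sup>2 / (1 + (x/a)\<^sup>2))" using x a by (simp add: g_def real_sqrt_abs)
    moreover have "(x/a)\<^sup>2 / (1 + (x/a)\<^sup>2) \<in> {0<..<1}" using x a 1 by (auto simp: divide_simps)
    ultimately show "x \<in> g ` {0<..<1}" by blast
  qed (use a in \<open>auto simp: g_def\<close>)
  have der: "(g has_field_derivative g' t) (at t within {0<..<1})" if "t \<in> {0<..<1}" for t
  proof -
    have "((\<lambda>t. t / (1 - t)) has_field_derivative 1 / (1 - t)\<^sup>2) (at t within {0<..<1})"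
      using that by (auto intro!: derivative_eq_intros simp: power2_eq_square divide_simps)
    moreover have "t / (1 - t) > 0" using that by auto
    ultimately show ?thesis unfolding g_def g'_def
      by (intro DERIV_cmult DERIV_chain2[OF DERIV_real_sqrt])
  qed
  have inj: "inj_on g {0<..<1}"
    using a by (auto simp: inj_on_def g_def field_simps)
  have eq: "\<bar>g' t\<bar> * f (g t) = a powr (s - 1) / 2 * (t powr (s/2 - 1) * (1 - t) powr ((1 - s/2) - 1))"
    if t: "t \<in> {0<..<1}" for t
  proof -
    define q where "q = t / (1 - t)"
    have q: "q > 0" using t by (simp add: q_def)
    have sq: "sqrt q = q powr (1/2)" using q by (simp add: powr_half_sqrt)
    have 1: "a / ((g t)\<^sup>2 + a\<^sup>2) = (1 - t) / a"
    proof -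
      have "(g t)\<^sup>2 + a\<^sup>2 = a\<^sup>2 * (q + 1)"
        using q by (simp add: g_def q_def [symmetric] power_mult_distrib algebra_simps)
      also have "q + 1 = 1 / (1 - t)" using t by (simp add: q_def field_simps)
      finally show ?thesis using a t by (simp add: power2_eq_square)
    qed
    have 2: "g t powr (s - 1) = a powr (s - 1) * q powr ((s - 1) / 2)"
      using a q by (simp add: g_def q_def [symmetric] powr_mult sq powr_powr)
    have 3: "\<bar>g' t\<bar> = a * q powr (-(1/2)) / 2 / (1 - t)\<^sup>2"
      using a q t by (simp add: g'_def q_def [symmetric] sq powr_minus)
    have "\<bar>g' t\<bar> * f (g t) = a powr (s - 1) / 2 * (q powr ((s - 1) / 2) * q powr (-(1/2))) / (1 - t)"
      using a t unfolding f_def 1 2 3 by (simp add: power2_eq_square)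
    also have "q powr ((s - 1) / 2) * q powr (-(1/2)) = q powr (s/2 - 1)"
      by (simp add: powr_add [symmetric] diff_divide_distrib)
    also have "\<dots> = t powr (s/2 - 1) * (1 - t) powr (1 - s/2)"
      using t powr_minus_divide[of "1 - t" "s/2 - 1"] unfolding q_def by (subst powr_divide) auto
    also have "(1 - t) powr (1 - s/2) = (1 - t) * (1 - t) powr ((1 - s/2) - 1)"
      using t by (simp add: powr_mult_base)
    finally have "\<bar>g' t\<bar> * f (g t) = a powr (s - 1) / 2 *
      (t powr (s/2 - 1) * ((1 - t) * (1 - t) powr ((1 - s/2) - 1))) / (1 - t)" .
    moreover have "A / 2 * (B * (c * D)) / c = A / 2 * (B * D)" if "c \<noteq> 0" for A B c D :: real
      using that by simp
    moreover have "1 - t \<noteq> 0" using t by auto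
    ultimately show ?thesis by (simp only:)
  qed
  have "(\<lambda>t. \<bar>g' t\<bar> * f (g t)) absolutely_integrable_on {0<..<1} \<and>
     integral {0<..<1} (\<lambda>t. \<bar>g' t\<bar> * f (g t)) = I"
  proof -
    have "((\<lambda>t. \<bar>g' t\<bar> * f (g t)) has_integral a powr (s - 1) / 2 * Beta (s/2) (1 - s/2)) {0<..<1}"
      by (rule has_integral_eq[OF _ has_integral_mult_right[OF B]]) (simp only: eq)
    moreover have "a powr (s - 1) / 2 * Beta (s/2) (1 - s/2) = I"
      using Gamma_reflection_real[of "s/2"] by (simp add: Beta_def I_def)
    moreover have "\<bar>g' t\<bar> * f (g t) \<ge> 0" for t using a by (simp add: f_def)
    ultimately show ?thesis
      by (subst absolutely_integrable_on_iff_nonneg) (auto simp: has_integral_iff)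
  qed
  also have "?this \<longleftrightarrow> f absolutely_integrable_on (g ` {0<..<1}) \<and> integral (g ` {0<..<1}) f = I"
    by (intro has_absolute_integral_change_of_variables_1' der inj) auto
  finally show "(\<lambda>u. u powr (s - 1) * (a / (u\<^sup>2 + a\<^sup>2))) absolutely_integrable_on {0<..} \<and>
     integral {0<..} (\<lambda>u. u powr (s - 1) * (a / (u\<^sup>2 + a\<^sup>2))) = a powr (s - 1) * (pi / (2 * sin (pi * s / 2)))"
    unfolding img f_def I_def .
qed auto

text \<open>Logarithmic derivative of the reflection formula: Gamma z Gamma (1 - z) sin (pi z) is
  constant off the integers.\<close>

lemma Digamma_reflection_complex:
  fixes z :: complex
  assumes z: "z \<notin> \<int>"
  shows "Digamma (1 - z) - Digamma z = of_real pi * cot (of_real pi * z)"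
proof -
  have z': "1 - z \<notin> \<int>" using z by (metis Ints_1 Ints_diff diff_diff_eq2 diff_add_cancel add_diff_cancel_left')
  have nz: "z \<notin> \<int>\<^sub>\<le>\<^sub>0" "1 - z \<notin> \<int>\<^sub>\<le>\<^sub>0" using z z' nonpos_Ints_subset_Ints by auto
  have sin: "sin (of_real pi * w) \<noteq> 0" if "w \<notin> \<int>" for w :: complex
    using that by (auto simp: sin_eq_0 mult.commute)
  have "((\<lambda>w. Gamma w * Gamma (1 - w) * sin (of_real pi * w)) has_field_derivative
     (Gamma z * Digamma z * Gamma (1 - z) * sin (of_real pi * z)
      - Gamma z * (Gamma (1 - z) * Digamma (1 - z)) * sin (of_real pi * z)
      + Gamma z * Gamma (1 - z) * (of_real pi * cos (of_real pi * z)))) (at z)"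
    using nz by (auto intro!: derivative_eq_intros simp: algebra_simps)
  moreover have "((\<lambda>w. Gamma w * Gamma (1 - w) * sin (of_real pi * w)) has_field_derivative 0) (at z)"
  proof (rule has_field_derivative_transform_within_open[OF DERIV_const])
    show "open (- (\<int> :: complex set))" using closed_Ints by blast
    show "of_real pi = Gamma w * Gamma (1 - w) * sin (of_real pi * w)" if "w \<in> - \<int>" for w :: complex
      using Gamma_reflection_complex[of w] sin[of w] that by simp
  qed (use z in auto)
  ultimately have "Gamma z * Digamma z * Gamma (1 - z) * sin (of_real pi * z)
      - Gamma z * (Gamma (1 - z) * Digamma (1 - z)) * sin (of_real pi * z)
      + Gamma z * Gamma (1 - z) * (of_real pi * cos (of_real pi * z)) = 0"
    by (rule DERIV_unique)
  hence "Gamma z * Gamma (1 - z) * (sin (of_real pi * z) * (Digamma z - Digamma (1 - z))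
      + of_real pi * cos (of_real pi * z)) = 0"
    by (simp only: ring_distribs mult_ac)
  moreover have "Gamma z * Gamma (1 - z) \<noteq> 0" using nz by (simp add: Gamma_eq_zero_iff)
  ultimately have "sin (of_real pi * z) * (Digamma z - Digamma (1 - z)) + of_real pi * cos (of_real pi * z) = 0"
    by simp
  thus ?thesis using sin[OF z] by (simp add: cot_def field_simps)
qed

text \<open>For u > 0 this is the sum of exp (- n u) sin (2 pi n x) over n. At u = 0 and
  non-integral x it equals cot (pi x) / 2, which is how the cotangent enters.\<close>

definition conj_Poisson :: "real \<Rightarrow> real \<Rightarrow> real" where
  "conj_Poisson x u = Im (1 / (1 - exp (Complex (- u) (2 * pi * x))))"

text \<open>With q = exp (2 i w) one has cot w = i - 2 i / (1 - q), and the real part of - 2 i c is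
  2 Im c. The assumption excludes q = 1.\<close>

lemma Re_cot_eq_conj_Poisson:
  assumes "x \<notin> \<int> \<or> u \<noteq> 0"
  shows "Re (cot (of_real pi * Complex x (u / (2 * pi)))) = 2 * conj_Poisson x u"
proof -
  define w where "w = of_real pi * Complex x (u / (2 * pi))"
  define q where "q = exp (2 * \<i> * w)"
  have "2 * \<i> * w = Complex (- u) (2 * pi * x)"
    by (simp add: w_def complex_eq_iff)
  hence q: "q = exp (Complex (- u) (2 * pi * x))" by (simp add: q_def)
  have "q \<noteq> 1"
  proof
    assume "q = 1"
    then obtain n :: int where "u = 0" "2 * pi * x = of_int (2 * n) * pi"
      unfolding q exp_eq_1 by auto
    thus False using assms by auto
  qed
  have e: "exp (\<i> * w) * exp (\<i> * w) = q" unfolding q_def exp_add [symmetric] by (simp add: algebra_simps)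
  have "cot w = \<i> * (exp (\<i> * w) + exp (- (\<i> * w))) / (exp (\<i> * w) - exp (- (\<i> * w)))"
  proof -
    have "(c / 2) / (d / (2 * \<i>)) = \<i> * c / d" for c d :: complex
      by (cases "d = 0") (simp_all add: field_simps)
    thus ?thesis unfolding cot_def cos_exp_eq sin_exp_eq .
  qed
  also have "\<dots> = \<i> * (exp (\<i> * w) * (exp (\<i> * w) + exp (- (\<i> * w)))) /
       (exp (\<i> * w) * (exp (\<i> * w) - exp (- (\<i> * w))))" by simp
  also have "\<dots> = \<i> * (q + 1) / (q - 1)"
    by (simp add: ring_distribs e exp_minus_inverse)
  also have "\<dots> = \<i> - 2 * \<i> * (1 / (1 - q))"
    using \<open>q \<noteq> 1\<close> by (simp add: field_simps)
  also have "Re \<dots> = 2 * Im (1 / (1 - q))"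
  proof -
    have "Re (\<i> - 2 * \<i> * c) = 2 * Im c" for c by simp
    thus ?thesis .
  qed
  finally have "Re (cot w) = 2 * Im (1 / (1 - q))" .
  thus ?thesis by (simp add: w_def conj_Poisson_def q)
qed

text \<open>The digamma series at 1 - z and z subtract to the cotangent expansion, with the poles
  paired as in \<open>odd_hz\<close>; taking real parts at z = x + i u / (2 pi) and rescaling gives
  Poisson kernels.\<close>

lemma conj_Poisson_partial_fractions:
  assumes x: "0 < x" "x < 1"
  shows "(\<lambda>k. 2 * pi * (real k + x) / (u\<^sup>2 + (2 * pi * (real k + x))\<^sup>2)
            - 2 * pi * (real k + 1 - x) / (u\<^sup>2 + (2 * pi * (real k + 1 - x))\<^sup>2)) sums conj_Poisson x u"
proof -
  define y where "y = u / (2 * pi)"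
  define z where "z = Complex x y"
  have xI: "x \<notin> \<int>" using x by (auto elim!: Ints_cases)
  have z: "z \<notin> \<int>"
  proof
    assume "z \<in> \<int>"
    then obtain n where "z = of_int n" by (auto elim: Ints_cases)
    hence "x = of_int n" by (simp add: z_def complex_eq_iff)
    thus False using xI by auto
  qed
  have z0: "z \<noteq> 0" "1 - z \<noteq> 0" using z by auto
  have D: "(\<lambda>k. inverse (of_nat (Suc k)) - inverse (y + of_nat k)) sums (Digamma y + euler_mascheroni)"
    if "y \<noteq> 0" for y :: complex
    using summable_sums[OF summable_Digamma[OF that]] by (simp add: Digamma_def)
  have "(\<lambda>k. (inverse (of_nat (Suc k)) - inverse (1 - z + of_nat k)) - (inverse (of_nat (Suc k)) - inverse (z + of_nat k)))
     sums ((Digamma (1 - z) + euler_mascheroni) - (Digamma z + euler_mascheroni))"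
    by (intro sums_diff D z0)
  hence "(\<lambda>k. inverse (z + of_nat k) - inverse (1 - z + of_nat k)) sums (of_real pi * cot (of_real pi * z))"
    using Digamma_reflection_complex[OF z] by simp
  hence "(\<lambda>k. Re (inverse (z + of_nat k) - inverse (1 - z + of_nat k))) sums Re (of_real pi * cot (of_real pi * z))"
    by (rule sums_Re)
  hence "(\<lambda>k. Re (inverse (z + of_nat k) - inverse (1 - z + of_nat k)) / (2 * pi)) sums
      (Re (of_real pi * cot (of_real pi * z)) / (2 * pi))" by (rule sums_divide)
  also have "Re (of_real pi * cot (of_real pi * z)) / (2 * pi) = conj_Poisson x u"
    using Re_cot_eq_conj_Poisson[of x u] xI by (simp add: z_def y_def)
  also have "(\<lambda>k. Re (inverse (z + of_nat k) - inverse (1 - z + of_nat k)) / (2 * pi)) =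
     (\<lambda>k. 2 * pi * (real k + x) / (u\<^sup>2 + (2 * pi * (real k + x))\<^sup>2)
            - 2 * pi * (real k + 1 - x) / (u\<^sup>2 + (2 * pi * (real k + 1 - x))\<^sup>2))"
  proof
    fix k
    have P: "c / (c\<^sup>2 + y\<^sup>2) / (2 * pi) = 2 * pi * c / (u\<^sup>2 + (2 * pi * c)\<^sup>2)" if "c > 0" for c
    proof -
      have u: "u = 2 * pi * y" by (simp add: y_def)
      have "u\<^sup>2 + (2 * pi * c)\<^sup>2 = (2 * pi) * ((2 * pi) * (c\<^sup>2 + y\<^sup>2))"
        unfolding u by (simp add: power2_eq_square algebra_simps)
      thus ?thesis by simp
    qed
    have "Re (inverse (z + of_nat k)) = (real k + x) / ((real k + x)\<^sup>2 + y\<^sup>2)"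
      by (simp add: z_def add_ac)
    moreover have "Re (inverse (1 - z + of_nat k)) = (real k + 1 - x) / ((real k + 1 - x)\<^sup>2 + y\<^sup>2)"
      by (simp add: z_def algebra_simps)
    ultimately show "Re (inverse (z + of_nat k) - inverse (1 - z + of_nat k)) / (2 * pi) =
      2 * pi * (real k + x) / (u\<^sup>2 + (2 * pi * (real k + x))\<^sup>2)
            - 2 * pi * (real k + 1 - x) / (u\<^sup>2 + (2 * pi * (real k + 1 - x))\<^sup>2)"
      using P[of "real k + x"] P[of "real k + 1 - x"] x by (simp add: diff_divide_distrib)
  qed
  finally show ?thesis .
qed

section \<open>Finite Fourier analysis\<close>

lemma has_bochner_integral_sums:
  fixes f :: "nat \<Rightarrow> 'a \<Rightarrow> real"
  assumes f: "\<And>i. has_bochner_integral M (f i) (I i)"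
    and norm: "\<And>x. x \<in> space M \<Longrightarrow> summable (\<lambda>i. norm (f i x))"
    and norm': "summable (\<lambda>i. \<integral>x. norm (f i x) \<partial>M)"
    and g: "\<And>x. x \<in> space M \<Longrightarrow> (\<lambda>i. f i x) sums g x"
    and I: "I sums J"
  shows "has_bochner_integral M g J"
proof -
  have int: "integrable M (f i)" and eq: "integral\<^sup>L M (f i) = I i" for i
    using f by (auto simp: has_bochner_integral_iff)
  have ae: "AE x in M. summable (\<lambda>i. norm (f i x))" using norm by (intro AE_I2)
  have "has_bochner_integral M (\<lambda>x. \<Sum>i. f i x) J"
    using integrable_suminf[OF int ae norm'] integral_suminf[OF int ae norm'] I
    by (simp add: has_bochner_integral_iff eq sums_iff)
  also have "?this \<longleftrightarrow> ?thesis"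
    by (intro has_bochner_integral_cong refl) (use g in \<open>auto simp: sums_iff\<close>)
  finally show ?thesis .
qed

lemma cis_eq_1_iff_dvd:
  assumes "m > 0"
  shows "cis (2 * pi * of_int j / of_nat m) = 1 \<longleftrightarrow> int m dvd j"
proof
  assume "cis (2 * pi * of_int j / of_nat m) = 1"
  then obtain n :: int where "2 * pi * of_int j / of_nat m = of_int (2 * n) * pi"
    unfolding cis_conv_exp exp_eq_1 by auto
  hence "real_of_int j = real_of_int (n * int m)" using assms by (simp add: field_simps)
  hence "j = n * int m" by (simp only: of_int_eq_iff)
  thus "int m dvd j" by simp
next
  assume "int m dvd j"
  then obtain n where "j = int m * n" by auto
  hence "2 * pi * of_int j / of_nat m = 2 * pi * of_int n" using assms by simp
  thus "cis (2 * pi * of_int j / of_nat m) = 1" using cis_multiple_2pi[of "of_int n"] by simp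
qed

lemma sum_cos_roots_of_unity:
  assumes m: "m > 0"
  shows "(\<Sum>l<m. cos (2 * pi * of_int j * real l / real m)) = (if int m dvd j then real m else 0)"
proof -
  define z where "z = cis (2 * pi * of_int j / of_nat m)"
  have zl: "z ^ l = cis (2 * pi * of_int j * real l / real m)" for l
    unfolding z_def by (simp add: Complex.DeMoivre mult_ac)
  have zm: "z ^ m = 1" using m cis_multiple_2pi[of "of_int j"] by (simp add: zl)
  have "(\<Sum>l<m. z ^ l) = (if int m dvd j then of_nat m else 0)"
  proof (cases "z = 1")
    case True
    thus ?thesis using cis_eq_1_iff_dvd[OF m, of j] by (simp add: z_def)
  next
    case False
    thus ?thesis using cis_eq_1_iff_dvd[OF m, of j] zm by (simp add: z_def [symmetric] geometric_sum)
  qed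
  hence "Re (\<Sum>l<m. z ^ l) = (if int m dvd j then real m else 0)" by simp
  thus ?thesis by (simp add: zl)
qed

text \<open>Writing the product as a difference of cosines, orthogonality selects n = r and n = m -
  r. If 2 r = m, both indicators apply and cancel, in accordance with sin (pi l) = 0.\<close>

lemma sum_sin_mult_sin:
  assumes r: "0 < r" "r < m" and n: "n < m"
  shows "(\<Sum>l<m. sin (2 * pi * real r * real l / real m) * sin (2 * pi * real n * real l / real m)) =
     real m / 2 * (of_bool (n = r) - of_bool (n = m - r))"
proof -
  have "(\<Sum>l<m. sin (2 * pi * real r * real l / real m) * sin (2 * pi * real n * real l / real m)) =
     (\<Sum>l<m. (cos (2 * pi * of_int (int r - int n) * real l / real m)
       - cos (2 * pi * of_int (int r + int n) * real l / real m)) / 2)"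
    by (intro sum.cong refl, subst sin_times_sin) (simp add: ring_distribs diff_divide_distrib add_divide_distrib)
  also have "\<dots> = ((if int m dvd int r - int n then real m else 0) - (if int m dvd int r + int n then real m else 0)) / 2"
    unfolding sum_divide_distrib [symmetric] sum_subtractf
    using r by (subst (1 2) sum_cos_roots_of_unity) auto
  also have "int m dvd int r - int n \<longleftrightarrow> n = r"
  proof
    assume "int m dvd int r - int n"
    hence "int r mod int m = int n mod int m" by (simp add: mod_eq_dvd_iff)
    thus "n = r" using r n by simp
  qed auto
  also have "int m dvd int r + int n \<longleftrightarrow> n = m - r"
  proof
    assume "int m dvd int r + int n"
    then obtain c where c: "int r + int n = int m * c" by auto
    have "int m * 0 < int m * c" "int m * c < int m * 2" unfolding c [symmetric] using r n by auto
    hence "0 < c" "c < 2" using r by (simp_all only: mult_less_cancel_left_pos of_nat_0_less_iff)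
    hence "c = 1" by auto
    thus "n = m - r" using c r by auto
  qed (use r in auto)
  finally show ?thesis by simp
qed

text \<open>Since q ^ m is the real number exp (- u) ^ m, summing one period of the geometric series
  gives a denominator that does not depend on l. This is what allows the kernels to be combined over
  l.\<close>

lemma conj_Poisson_rational:
  assumes m: "m > 0" and u: "u > 0"
  shows "conj_Poisson (real l / real m) u =
    (\<Sum>n<m. exp (- u) ^ n * sin (2 * pi * real n * real l / real m)) / (1 - exp (- u) ^ m)"
proof -
  define q where "q = exp (Complex (- u) (2 * pi * (real l / real m)))"
  have q: "q ^ n = of_real (exp (- u) ^ n) * cis (2 * pi * real n * real l / real m)" for n
  proof -
    have "q ^ n = (of_real (exp (- u)) * cis (2 * pi * (real l / real m))) ^ n"
      by (simp add: q_def exp_eq_polar exp_of_real)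
    also have "\<dots> = of_real (exp (- u) ^ n) * cis (2 * pi * real n * real l / real m)"
      by (simp only: power_mult_distrib of_real_power Complex.DeMoivre) (simp add: mult_ac)
    finally show ?thesis .
  qed
  have qm: "q ^ m = of_real (exp (- u) ^ m)"
    using m cis_multiple_2pi[of "real l"] unfolding q by (simp add: mult.assoc)
  have X: "exp (- u) ^ m < 1" using u m by (simp add: power_less_one_iff)
  have "q ^ m \<noteq> 1" using X unfolding qm of_real_eq_1_iff by simp
  hence "q \<noteq> 1" by auto
  hence "(\<Sum>n<m. q ^ n) = (1 - q ^ m) / (1 - q)"
    by (simp add: geometric_sum) (simp add: field_simps)
  hence "1 / (1 - q) = (\<Sum>n<m. q ^ n) / of_real (1 - exp (- u) ^ m)"
    using \<open>q ^ m \<noteq> 1\<close> \<open>q \<noteq> 1\<close> by (simp add: field_simps qm)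
  hence "conj_Poisson (real l / real m) u = Im ((\<Sum>n<m. q ^ n) / of_real (1 - exp (- u) ^ m))"
    by (simp add: conj_Poisson_def q_def)
  also have "\<dots> = (\<Sum>n<m. Im (q ^ n)) / (1 - exp (- u) ^ m)"
    by (simp only: Im_divide_of_real Im_sum)
  also have "(\<Sum>n<m. Im (q ^ n)) = (\<Sum>n<m. exp (- u) ^ n * sin (2 * pi * real n * real l / real m))"
    by (intro sum.cong refl) (simp add: q del: of_real_power)
  finally show ?thesis .
qed

lemma sum_lessThan_eq_1:
  fixes f :: "nat \<Rightarrow> 'a :: comm_monoid_add"
  assumes "f 0 = 0"
  shows "(\<Sum>l<m. f l) = (\<Sum>l=1..m-1. f l)"
  by (rule sum.mono_neutral_right) (use assms in \<open>auto simp: not_le\<close>)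

text \<open>Sine orthogonality extracts two powers of exp (- u). The right-hand side is the
  generating function of the progressions r + m k and m - r + m k, hence the Mellin integrand for
  \<open>odd_hz\<close> at r / m.\<close>

lemma conj_Poisson_finite_Fourier:
  assumes r: "0 < r" "r < m" and u: "u > 0"
  shows "(\<Sum>l=1..m-1. sin (2 * pi * real r * real l / real m) * conj_Poisson (real l / real m) u) =
    real m / 2 * ((exp (- u) ^ r - exp (- u) ^ (m - r)) / (1 - exp (- u) ^ m))"
proof -
  define X where "X = exp (- u)"
  have "(\<Sum>l=1..m-1. sin (2 * pi * real r * real l / real m) * conj_Poisson (real l / real m) u) =
     (\<Sum>l<m. sin (2 * pi * real r * real l / real m) * conj_Poisson (real l / real m) u)"
    by (rule sum_lessThan_eq_1 [symmetric]) simp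
  also have "\<dots> = (\<Sum>l<m. \<Sum>n<m. X ^ n *
     (sin (2 * pi * real r * real l / real m) * sin (2 * pi * real n * real l / real m))) / (1 - X ^ m)"
    unfolding X_def sum_divide_distrib
    by (intro sum.cong refl, subst conj_Poisson_rational) (use r u in \<open>auto simp: sum_distrib_left sum_divide_distrib mult_ac\<close>)
  also have "(\<Sum>l<m. \<Sum>n<m. X ^ n *
     (sin (2 * pi * real r * real l / real m) * sin (2 * pi * real n * real l / real m))) =
     (\<Sum>n<m. X ^ n * (real m / 2 * (of_bool (n = r) - of_bool (n = m - r))))"
    by (subst sum.swap) (intro sum.cong refl, use r in \<open>auto simp: sum_distrib_left [symmetric] sum_sin_mult_sin\<close>)
  also have "\<dots> = real m / 2 * ((\<Sum>n<m. X ^ n * of_bool (n = r)) - (\<Sum>n<m. X ^ n * of_bool (n = m - r)))"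
    unfolding sum_subtractf [symmetric] sum_distrib_left by (intro sum.cong refl) (simp add: algebra_simps)
  also have "(\<Sum>n<m. X ^ n * of_bool (n = r)) = X ^ r" using r by (simp add: of_bool_def if_distrib cong: if_cong)
  also have "(\<Sum>n<m. X ^ n * of_bool (n = m - r)) = X ^ (m - r)" using r by (simp add: of_bool_def if_distrib cong: if_cong)
  finally show ?thesis by (simp add: X_def)
qed

lemma sum_mult_sin_eq_cot:
  assumes r: "0 < r" "r < m"
  shows "(\<Sum>l=1..m-1. real l * sin (2 * pi * real r * real l / real m)) = - (real m / 2) * cot (pi * real r / real m)"
proof -
  define z where "z = cis (2 * pi * of_int (int r) / of_nat m)"
  have zl: "z ^ l = cis (2 * pi * real r * real l / real m)" for l
    unfolding z_def by (simp add: Complex.DeMoivre mult_ac)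
  have zm: "z ^ m = 1" using r cis_multiple_2pi[of "real r"] by (simp add: zl mult.assoc)
  have z1: "z \<noteq> 1"
    unfolding z_def using r zdvd_not_zless[of "int r" "int m"] by (subst cis_eq_1_iff_dvd) auto
  \<comment> \<open>Summation by parts. For k = m the geometric sum vanishes, leaving m / (z - 1),
    whose imaginary part is - m times the kernel at u = 0.\<close>
  have "(\<Sum>l<k. of_nat l * z ^ l) * (z - 1) = of_nat k * z ^ k - z * (\<Sum>l<k. z ^ l)" for k
    by (induction k) (simp_all add: algebra_simps)
  from this[of m] have "(\<Sum>l<m. of_nat l * z ^ l) * (z - 1) = of_nat m"
    using z1 zm by (simp add: geometric_sum)
  hence "(\<Sum>l<m. of_nat l * z ^ l) = - of_nat m * (1 / (1 - z))"
    using z1 by (simp add: field_simps)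
  moreover have "Im (- of_nat m * c) = - real m * Im c" for c by simp
  ultimately have "Im (\<Sum>l<m. of_nat l * z ^ l) = - real m * Im (1 / (1 - z))" by (simp only:)
  also have "1 / (1 - z) = 1 / (1 - exp (Complex (-0) (2 * pi * (real r / real m))))"
    by (simp add: z_def exp_eq_polar)
  also have "Im \<dots> = conj_Poisson (real r / real m) 0" by (simp only: conj_Poisson_def)
  also have "conj_Poisson (real r / real m) 0 = cot (pi * real r / real m) / 2"
  proof -
    have "real r / real m \<notin> \<int>"
    proof
      assume "real r / real m \<in> \<int>"
      then obtain n where n: "real r / real m = of_int n" by (elim Ints_cases)
      have "0 < real r / real m" "real r / real m < 1" using r by auto
      thus False unfolding n by simp
    qed
    hence "2 * conj_Poisson (real r / real m) 0 = Re (cot (of_real pi * Complex (real r / real m) (0 / (2 * pi))))"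
      by (subst Re_cot_eq_conj_Poisson) auto
    also have "of_real pi * Complex (real r / real m) (0 / (2 * pi)) = of_real (pi * real r / real m)"
      by (simp add: complex_eq_iff)
    also have "cot (complex_of_real (pi * real r / real m)) = of_real (cot (pi * real r / real m))"
      by (rule cot_of_real [symmetric])
    finally show ?thesis by simp
  qed
  also have "Im (\<Sum>l<m. of_nat l * z ^ l) = (\<Sum>l<m. real l * sin (2 * pi * real r * real l / real m))"
    by (simp add: zl)
  also have "\<dots> = (\<Sum>l=1..m-1. real l * sin (2 * pi * real r * real l / real m))"
    by (rule sum_lessThan_eq_1) simp
  finally show ?thesis by simp
qed

section \<open>The functional equation of the odd part\<close>

text \<open>Expanding the denominator geometrically produces the exponents r + m k = m (k + v) and m
  - r + m k = m (k + 1 - v), each integrated by Euler's integral for Gamma.\<close>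

lemma Mellin_odd_hz:
  assumes s: "0 < s" "s < 1" and r: "0 < r" "r < m"
  shows "has_bochner_integral (lebesgue_on {0<..})
     (\<lambda>u. u powr (s - 1) * ((exp (- u) ^ r - exp (- u) ^ (m - r)) / (1 - exp (- u) ^ m)))
     (Gamma s * real m powr (- s) * odd_hz (real r / real m) s)"
proof (rule has_bochner_integral_sums)
  let ?M = "lebesgue_on {0::real<..}"
  define v where "v = real r / real m"
  have v: "0 < v" "v < 1" using r by (auto simp: v_def)
  define a where "a = (\<lambda>k. real m * (real k + v))"
  define b where "b = (\<lambda>k. real m * (real k + 1 - v))"
  have ab: "a k > 0" "b k > 0" for k using r v by (auto simp: a_def b_def)
  define f where "f = (\<lambda>k u. u powr (s - 1) * exp (- a k * u) - u powr (s - 1) * exp (- b k * u))"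
  define I where "I = (\<lambda>k. Gamma s * real m powr (- s) * ((real k + v) powr (- s) - (real k + 1 - v) powr (- s)))"
  have "has_bochner_integral ?M (f k) (Gamma s * a k powr (- s) - Gamma s * b k powr (- s))" for k
    unfolding f_def using s ab by (intro has_bochner_integral_diff Gamma_integral_scaled)
  moreover have "Gamma s * a k powr (- s) - Gamma s * b k powr (- s) = I k" for k
  proof -
    have "a k powr (- s) = real m powr (- s) * (real k + v) powr (- s)"
      "b k powr (- s) = real m powr (- s) * (real k + 1 - v) powr (- s)"
      using r v unfolding a_def b_def by (simp_all only: powr_mult)
    thus ?thesis by (simp add: I_def right_diff_distrib mult_ac)
  qed
  ultimately show f: "has_bochner_integral ?M (f k) (I k)" for k by simp
  show I: "I sums (Gamma s * real m powr (- s) * odd_hz (real r / real m) s)"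
    unfolding I_def v_def [symmetric] by (intro sums_mult odd_hz_sums v s)
  define q where "q = (\<lambda>u :: real. exp (- u) ^ m)"
  have fk: "f k u = u powr (s - 1) * (exp (- u) ^ r - exp (- u) ^ (m - r)) * q u ^ k" for k u
  proof -
    have "a k = real (r + m * k)" "b k = real (m - r + m * k)"
      using r by (auto simp: a_def b_def v_def field_simps of_nat_diff)
    hence "exp (- a k * u) = exp (- u) ^ (r + m * k)" "exp (- b k * u) = exp (- u) ^ (m - r + m * k)"
      by (simp_all add: exp_of_nat_mult [symmetric] del: of_nat_add of_nat_mult)
    hence e: "exp (- a k * u) = exp (- u) ^ r * q u ^ k" "exp (- b k * u) = exp (- u) ^ (m - r) * q u ^ k"
      by (simp_all only: power_add power_mult q_def)
    show ?thesis unfolding f_def e by (simp add: algebra_simps)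
  qed
  have q: "0 < q u" "q u < 1" if "u > 0" for u
    using that r by (auto simp: q_def power_less_one_iff)
  show "(\<lambda>k. f k u) sums (u powr (s - 1) * ((exp (- u) ^ r - exp (- u) ^ (m - r)) / (1 - exp (- u) ^ m)))"
    if "u \<in> space ?M" for u
  proof -
    have "(\<lambda>k. q u ^ k) sums (1 / (1 - q u))"
      using q[of u] that by (intro geometric_sums) auto
    from sums_mult[OF this] show ?thesis by (simp add: fk q_def)
  qed
  show "summable (\<lambda>k. norm (f k u))" if "u \<in> space ?M" for u
    unfolding fk norm_mult norm_power
    by (intro summable_mult summable_geometric) (use q[of u] that in auto)
  \<comment> \<open>The sign of every term depends only on whether r <= m - r, not on k or u. Hence
    the integrals of the absolute values are, up to this sign, the terms of a series already known
    to converge.\<close>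
  define \<sigma> :: real where "\<sigma> = (if r \<le> m - r then 1 else -1)"
  have norm_f: "norm (f k u) = \<sigma> * f k u" if "u > 0" for k u
  proof -
    have "\<sigma> * (exp (- u) ^ r - exp (- u) ^ (m - r)) \<ge> 0"
      using that r by (auto simp: \<sigma>_def intro!: power_decreasing)
    hence "\<bar>exp (- u) ^ r - exp (- u) ^ (m - r)\<bar> = \<sigma> * (exp (- u) ^ r - exp (- u) ^ (m - r))"
      by (auto simp: \<sigma>_def split: if_splits)
    thus ?thesis unfolding fk using q[OF that] by (simp add: abs_mult)
  qed
  have "(\<integral>u. norm (f k u) \<partial>?M) = \<sigma> * I k" for k
  proof -
    have "(\<integral>u. norm (f k u) \<partial>?M) = (\<integral>u. \<sigma> * f k u \<partial>?M)"
      by (intro Bochner_Integration.integral_cong refl norm_f) auto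
    thus ?thesis using f[of k] by (simp add: has_bochner_integral_iff)
  qed
  thus "summable (\<lambda>k. \<integral>u. norm (f k u) \<partial>?M)"
    using I by (simp add: summable_mult sums_iff)
qed

text \<open>The numerator of the difference is (a - b) (u^2 - a b), and (u^2 + a b)^2 <= (u^2 + a^2)
  (u^2 + b^2) is Cauchy-Schwarz. For a and b of size k at bounded distance this gains a factor 1 / k
  over the single kernels.\<close>

lemma abs_Poisson_kernel_diff_le:
  fixes a b c u :: real
  assumes "0 < c" "c \<le> a" "c \<le> b"
  shows "\<bar>a / (u\<^sup>2 + a\<^sup>2) - b / (u\<^sup>2 + b\<^sup>2)\<bar> \<le> \<bar>a - b\<bar> / (u\<^sup>2 + c\<^sup>2)"
proof -
  have pos: "u\<^sup>2 + a\<^sup>2 > 0" "u\<^sup>2 + b\<^sup>2 > 0" "u\<^sup>2 + c\<^sup>2 > 0"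
    using assms by (auto intro!: add_nonneg_pos)
  have "\<bar>u\<^sup>2 - a * b\<bar> * (u\<^sup>2 + c\<^sup>2) \<le> (u\<^sup>2 + a\<^sup>2) * (u\<^sup>2 + b\<^sup>2)"
  proof -
    have c: "c\<^sup>2 \<le> a * b" "c\<^sup>2 \<le> a\<^sup>2" "c\<^sup>2 \<le> b\<^sup>2"
      using assms by (auto simp: power2_eq_square intro!: mult_mono)
    have "\<bar>u\<^sup>2 - a * b\<bar> \<le> u\<^sup>2 + a * b" using assms by (auto simp: abs_if)
    hence "\<bar>u\<^sup>2 - a * b\<bar> * (u\<^sup>2 + c\<^sup>2) \<le> (u\<^sup>2 + a * b) * (u\<^sup>2 + a * b)"
      using assms c by (intro mult_mono) auto
    also have "\<dots> \<le> (u\<^sup>2 + a\<^sup>2) * (u\<^sup>2 + b\<^sup>2)"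
    proof -
      have "(u\<^sup>2 + a\<^sup>2) * (u\<^sup>2 + b\<^sup>2) - (u\<^sup>2 + a * b) * (u\<^sup>2 + a * b) = u\<^sup>2 * (a - b)\<^sup>2"
        by (simp add: power2_eq_square algebra_simps)
      thus ?thesis by (metis diff_ge_0_iff_ge zero_le_mult_iff zero_le_power2)
    qed
    finally show ?thesis .
  qed
  note le = this
  have 1: "\<bar>u\<^sup>2 - a * b\<bar> / ((u\<^sup>2 + a\<^sup>2) * (u\<^sup>2 + b\<^sup>2)) \<le> 1 / (u\<^sup>2 + c\<^sup>2)"
  proof -
    have "X / Y \<le> 1 / Z" if "X * Z \<le> Y" "Y > 0" "Z > 0" for X Y Z :: real
      using that by (simp add: divide_simps mult_ac)
    thus ?thesis using pos le by (meson mult_pos_pos)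
  qed
  have "a / (u\<^sup>2 + a\<^sup>2) - b / (u\<^sup>2 + b\<^sup>2) = (a * (u\<^sup>2 + b\<^sup>2) - b * (u\<^sup>2 + a\<^sup>2)) / ((u\<^sup>2 + a\<^sup>2) * (u\<^sup>2 + b\<^sup>2))"
    using pos by (intro diff_frac_eq) auto
  also have "a * (u\<^sup>2 + b\<^sup>2) - b * (u\<^sup>2 + a\<^sup>2) = (a - b) * (u\<^sup>2 - a * b)"
    by (simp add: power2_eq_square algebra_simps)
  finally have "\<bar>a / (u\<^sup>2 + a\<^sup>2) - b / (u\<^sup>2 + b\<^sup>2)\<bar> =
      \<bar>a - b\<bar> * (\<bar>u\<^sup>2 - a * b\<bar> / ((u\<^sup>2 + a\<^sup>2) * (u\<^sup>2 + b\<^sup>2)))"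
    using pos by (simp add: abs_mult)
  also have "\<dots> \<le> \<bar>a - b\<bar> * (1 / (u\<^sup>2 + c\<^sup>2))" by (intro mult_left_mono 1) auto
  finally show ?thesis by simp
qed

text \<open>Each Poisson kernel contributes a power with exponent s - 1 = - (1 - s), so the termwise
  integral is \<open>odd_hz\<close> at the reflected point. The interchange is justified by a
  majorant with integral O(k powr (s - 2)), summable because s < 1.\<close>

lemma Mellin_conj_Poisson:
  assumes s: "0 < s" "s < 1" and x: "0 < x" "x < 1"
  shows "has_bochner_integral (lebesgue_on {0<..}) (\<lambda>u. u powr (s - 1) * conj_Poisson x u)
     (pi / (2 * sin (pi * s / 2)) * (2 * pi) powr (s - 1) * odd_hz x (1 - s))"
proof (rule has_bochner_integral_sums)
  let ?M = "lebesgue_on {0::real<..}"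
  define C where "C = pi / (2 * sin (pi * s / 2))"
  define K where "K = (\<lambda>a u::real. u powr (s - 1) * (a / (u\<^sup>2 + a\<^sup>2)))"
  define a where "a = (\<lambda>k. 2 * pi * (real k + x))"
  define b where "b = (\<lambda>k. 2 * pi * (real k + 1 - x))"
  have ab: "a k > 0" "b k > 0" for k using x by (auto simp: a_def b_def)
  have K: "has_bochner_integral ?M (K c) (c powr (s - 1) * C)" if "c > 0" for c
    unfolding K_def C_def using s that by (intro Poisson_kernel_integral) auto
  define f where "f = (\<lambda>k u. K (a k) u - K (b k) u)"
  define I where "I = (\<lambda>k. C * (2 * pi) powr (s - 1) * ((real k + x) powr (- (1 - s)) - (real k + 1 - x) powr (- (1 - s))))"
  have "has_bochner_integral ?M (f k) (a k powr (s - 1) * C - b k powr (s - 1) * C)" for k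
    unfolding f_def using ab by (intro has_bochner_integral_diff K)
  moreover have "a k powr (s - 1) * C - b k powr (s - 1) * C = I k" for k
  proof -
    have "a k powr (s - 1) = (2 * pi) powr (s - 1) * (real k + x) powr (s - 1)"
      "b k powr (s - 1) = (2 * pi) powr (s - 1) * (real k + 1 - x) powr (s - 1)"
      using x unfolding a_def b_def by (simp_all only: powr_mult)
    thus ?thesis by (simp add: I_def right_diff_distrib mult_ac)
  qed
  ultimately show f: "has_bochner_integral ?M (f k) (I k)" for k by simp
  show "I sums (pi / (2 * sin (pi * s / 2)) * (2 * pi) powr (s - 1) * odd_hz x (1 - s))"
    unfolding I_def C_def [symmetric] using s by (intro sums_mult odd_hz_sums x) auto
  show "(\<lambda>k. f k u) sums (u powr (s - 1) * conj_Poisson x u)" for u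
    using sums_mult[OF conj_Poisson_partial_fractions[OF x, of u], of "u powr (s - 1)"]
    by (simp add: f_def K_def a_def b_def right_diff_distrib)
  \<comment> \<open>A common lower bound of \<open>a k\<close> and \<open>b k\<close>. It vanishes
    at k = 0, so the estimates are only made for k > 0.\<close>
  define c where "c = (\<lambda>k. 2 * pi * real k)"
  have bound: "norm (f k u) \<le> (1 / real k) * K (c k) u" if "k > 0" for k u
  proof -
    have "\<bar>a k / (u\<^sup>2 + (a k)\<^sup>2) - b k / (u\<^sup>2 + (b k)\<^sup>2)\<bar> \<le> \<bar>a k - b k\<bar> / (u\<^sup>2 + (c k)\<^sup>2)"
      using that x by (intro abs_Poisson_kernel_diff_le) (auto simp: a_def b_def c_def)
    also have "\<bar>a k - b k\<bar> = 2 * pi * \<bar>2 * x - 1\<bar>"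
    proof -
      have "a k - b k = 2 * pi * (2 * x - 1)" by (simp add: a_def b_def algebra_simps)
      thus ?thesis by (simp add: abs_mult)
    qed
    also have "\<dots> / (u\<^sup>2 + (c k)\<^sup>2) \<le> (2 * pi * 1) / (u\<^sup>2 + (c k)\<^sup>2)"
      using x by (intro divide_right_mono mult_left_mono) auto
    finally have "u powr (s - 1) * \<bar>a k / (u\<^sup>2 + (a k)\<^sup>2) - b k / (u\<^sup>2 + (b k)\<^sup>2)\<bar>
        \<le> u powr (s - 1) * ((2 * pi * 1) / (u\<^sup>2 + (c k)\<^sup>2))" by (intro mult_left_mono) auto
    moreover have "f k u = u powr (s - 1) * (a k / (u\<^sup>2 + (a k)\<^sup>2) - b k / (u\<^sup>2 + (b k)\<^sup>2))"
      by (simp only: f_def K_def right_diff_distrib)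
    moreover have "(1 / real k) * K (c k) u = u powr (s - 1) * ((2 * pi * 1) / (u\<^sup>2 + (c k)\<^sup>2))"
      using that by (simp add: K_def c_def)
    ultimately show ?thesis by (simp only: real_norm_def abs_mult abs_of_nonneg powr_ge_zero)
  qed
  have ev: "\<forall>\<^sub>F k in sequentially. k > (0 :: nat)" by (rule eventually_gt_at_top)
  show "summable (\<lambda>k. norm (f k u))" if "u \<in> space ?M" for u
  proof (rule summable_comparison_test_ev)
    have "summable (\<lambda>k. u powr (s - 1) / (2 * pi) * inverse (real k ^ 2))"
      by (intro summable_mult inverse_power_summable) auto
    thus "summable (\<lambda>k. u powr (s - 1) / (2 * pi) * inverse (real k ^ 2))" .
    show "\<forall>\<^sub>F k in sequentially. norm (norm (f k u)) \<le> u powr (s - 1) / (2 * pi) * inverse (real k ^ 2)"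
      using ev
    proof eventually_elim
      case (elim k)
      have "2 * pi / (u\<^sup>2 + (c k)\<^sup>2) \<le> 2 * pi / (c k)\<^sup>2"
        using elim by (intro divide_left_mono) (auto simp: c_def intro!: mult_pos_pos add_nonneg_pos)
      also have "\<dots> = inverse (real k ^ 2) / (2 * pi)" by (simp add: c_def power2_eq_square field_simps)
      finally have "u powr (s - 1) * (2 * pi / (u\<^sup>2 + (c k)\<^sup>2)) \<le> u powr (s - 1) * (inverse (real k ^ 2) / (2 * pi))"
        by (intro mult_left_mono) auto
      moreover have "(1 / real k) * K (c k) u = u powr (s - 1) * (2 * pi / (u\<^sup>2 + (c k)\<^sup>2))"
        using elim by (simp add: K_def c_def)
      ultimately show ?case using bound[OF elim, of u] by simp
    qed
  qed
  show "summable (\<lambda>k. \<integral>u. norm (f k u) \<partial>?M)"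
  proof (rule summable_comparison_test_ev)
    have "summable (\<lambda>k. C * (2 * pi) powr (s - 1) * real k powr (s - 2))"
      using s by (intro summable_mult) (simp add: summable_real_powr_iff)
    thus "summable (\<lambda>k. C * (2 * pi) powr (s - 1) * real k powr (s - 2))" .
    show "\<forall>\<^sub>F k in sequentially. norm (\<integral>u. norm (f k u) \<partial>?M) \<le> C * (2 * pi) powr (s - 1) * real k powr (s - 2)"
      using ev
    proof eventually_elim
      case (elim k)
      have c: "c k > 0" using elim by (simp add: c_def)
      have "(\<integral>u. norm (f k u) \<partial>?M) \<le> (\<integral>u. (1 / real k) * K (c k) u \<partial>?M)"
        using f[of k] K[OF c] bound[OF elim]
        by (intro integral_mono) (auto simp: has_bochner_integral_iff)
      also have "\<dots> = (1 / real k) * (c k powr (s - 1) * C)"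
        using K[OF c] by (simp add: has_bochner_integral_iff)
      also have "\<dots> = C * (2 * pi) powr (s - 1) * (real k powr (s - 1) / real k)"
        using elim by (simp add: c_def powr_mult)
      also have "real k powr (s - 1) / real k = real k powr (s - 2)"
        using elim by (simp add: powr_diff power2_eq_square)
      finally show ?case by simp
    qed
  qed
qed

text \<open>Hurwitz's formula at rational parameters, for the part that is odd under \<open>v \<mapsto> 1 - v\<close>.\<close>

lemma odd_hz_functional_equation:
  assumes s: "0 < s" "s < 1" and r: "0 < r" "r < m"
  shows "odd_hz (real r / real m) s = pi / (Gamma s * sin (pi * s / 2)) * (2 * pi * real m) powr (s - 1) *
           (\<Sum>l=1..m-1. sin (2 * pi * real r * real l / real m) * odd_hz (real l / real m) (1 - s))"
proof -
  let ?M = "lebesgue_on {0::real<..}"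
  let ?S = "\<lambda>l. sin (2 * pi * real r * real l / real m)"
  define C where "C = pi / (2 * sin (pi * s / 2)) * (2 * pi) powr (s - 1)"
  have "has_bochner_integral ?M (\<lambda>u. \<Sum>l=1..m-1. ?S l * (u powr (s - 1) * conj_Poisson (real l / real m) u))
     (\<Sum>l=1..m-1. ?S l * (C * odd_hz (real l / real m) (1 - s)))"
    unfolding C_def
    by (intro has_bochner_integral_sum has_bochner_integral_mult_right Mellin_conj_Poisson s) auto
  also have "?this \<longleftrightarrow> has_bochner_integral ?M (\<lambda>u. real m / 2 * (u powr (s - 1) *
       ((exp (- u) ^ r - exp (- u) ^ (m - r)) / (1 - exp (- u) ^ m))))
      (\<Sum>l=1..m-1. ?S l * (C * odd_hz (real l / real m) (1 - s)))"
  proof (intro has_bochner_integral_cong refl)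
    fix u assume "u \<in> space ?M"
    hence u: "u > 0" by simp
    have "(\<Sum>l=1..m-1. ?S l * (u powr (s - 1) * conj_Poisson (real l / real m) u)) =
      u powr (s - 1) * (\<Sum>l=1..m-1. ?S l * conj_Poisson (real l / real m) u)"
      by (simp add: sum_distrib_left mult_ac)
    thus "(\<Sum>l=1..m-1. ?S l * (u powr (s - 1) * conj_Poisson (real l / real m) u)) =
      real m / 2 * (u powr (s - 1) * ((exp (- u) ^ r - exp (- u) ^ (m - r)) / (1 - exp (- u) ^ m)))"
      using conj_Poisson_finite_Fourier[OF r u] by simp
  qed
  finally have 1: "has_bochner_integral ?M (\<lambda>u. real m / 2 * (u powr (s - 1) *
       ((exp (- u) ^ r - exp (- u) ^ (m - r)) / (1 - exp (- u) ^ m))))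
      (\<Sum>l=1..m-1. ?S l * (C * odd_hz (real l / real m) (1 - s)))" .
  \<comment> \<open>The same integral evaluated by the geometric expansion; equating it with the
    evaluation by partial fractions is the functional equation.\<close>
  have 2: "has_bochner_integral ?M (\<lambda>u. real m / 2 * (u powr (s - 1) *
       ((exp (- u) ^ r - exp (- u) ^ (m - r)) / (1 - exp (- u) ^ m))))
      (real m / 2 * (Gamma s * real m powr (- s) * odd_hz (real r / real m) s))"
    by (intro has_bochner_integral_mult_right Mellin_odd_hz s r)
  have "real m / 2 * (Gamma s * real m powr (- s) * odd_hz (real r / real m) s) =
     (\<Sum>l=1..m-1. ?S l * (C * odd_hz (real l / real m) (1 - s)))"
    by (rule has_bochner_integral_eq[OF 2 1])
  also have "\<dots> = C * (\<Sum>l=1..m-1. ?S l * odd_hz (real l / real m) (1 - s))"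
    by (simp add: sum_distrib_left mult_ac)
  finally have eq: "real m / 2 * (Gamma s * real m powr (- s) * odd_hz (real r / real m) s) = \<dots>" .
  have G: "Gamma s > 0" using s by simp
  have m: "real m > 0" using r by simp
  have "real m * real m powr (- s) = real m powr (1 - s)" using powr_mult_base[of "real m" "-s"] by simp
  hence mm: "real m * real m powr (- s) * real m powr (s - 1) = 1"
    using m by (simp add: powr_add [symmetric])
  have "Gamma s * odd_hz (real r / real m) s =
      (real m * real m powr (- s) * real m powr (s - 1)) * (Gamma s * odd_hz (real r / real m) s)"
    unfolding mm by simp
  also have "\<dots> = 2 * real m powr (s - 1) * (real m / 2 * (Gamma s * real m powr (- s) * odd_hz (real r / real m) s))"
    by (simp add: mult_ac)
  also have "\<dots> = 2 * real m powr (s - 1) * (C * (\<Sum>l=1..m-1. ?S l * odd_hz (real l / real m) (1 - s)))"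
    by (simp only: eq)
  also have "\<dots> = pi / sin (pi * s / 2) * (2 * pi * real m) powr (s - 1) *
      (\<Sum>l=1..m-1. ?S l * odd_hz (real l / real m) (1 - s))"
    using m by (simp add: C_def powr_mult)
  finally have "Gamma s * odd_hz (real r / real m) s = pi / sin (pi * s / 2) * (2 * pi * real m) powr (s - 1) *
      (\<Sum>l=1..m-1. ?S l * odd_hz (real l / real m) (1 - s))" .
  moreover have "X = A / (Y * D) * B * Z" if "Y * X = A / D * B * Z" "Y > 0" for A B D X Y Z :: real
    using that by (simp add: divide_simps mult_ac split: if_splits)
  ultimately show ?thesis using G by blast
qed

section \<open>Evaluation of the sum\<close>

text \<open>Factor H s = (s - 1) h s with h holomorphic; then H'' = 2 h' at 1, and W w = h (1 - w).
  Continuity of h forces L0 = h 1, and since h' exists at 1, the limit along s = 1 - w determines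
  it; reversing the direction gives the minus sign.\<close>

lemma deriv2_eq_of_one_sided_quotient:
  fixes H :: "complex \<Rightarrow> complex" and W :: "real \<Rightarrow> real"
  assumes H: "H holomorphic_on S" "open S" "1 \<in> S" "H 1 = 0"
    and W: "\<And>w. 0 < w \<Longrightarrow> w < 1 \<Longrightarrow> H (of_real (1 - w)) = of_real (- w * W w)"
    and lim: "((\<lambda>w. (W w - L0) / w) \<longlongrightarrow> L1) (at_right 0)"
  shows "deriv (deriv H) 1 = of_real (- 2 * L1)"
proof -
  define h where "h = (\<lambda>z. if z = 1 then deriv H 1 else (H z - H 1) / (z - 1))"
  have hol: "h holomorphic_on S"
    unfolding h_def by (rule pole_lemma_open) (use H in auto)
  have H_eq: "H s = (s - 1) * h s" for s
    using H by (simp add: h_def)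
  have dh: "(h has_field_derivative deriv h s) (at s)" if "s \<in> S" for s
    by (rule holomorphic_derivI[OF hol H(2) that])
  have ddh: "(deriv h has_field_derivative deriv (deriv h) s) (at s)" if "s \<in> S" for s
    by (rule holomorphic_derivI[OF holomorphic_deriv[OF hol H(2)] H(2) that])
  have dH: "deriv H s = h s + (s - 1) * deriv h s" if "s \<in> S" for s
  proof (rule DERIV_imp_deriv)
    have "((\<lambda>s. (s - 1) * h s) has_field_derivative (h s + (s - 1) * deriv h s)) (at s)"
      by (auto intro!: derivative_eq_intros dh that)
    thus "(H has_field_derivative (h s + (s - 1) * deriv h s)) (at s)"
      by (simp add: H_eq [abs_def])
  qed
  have ddH: "deriv (deriv H) 1 = 2 * deriv h 1"
  proof (rule DERIV_imp_deriv)
    have "((\<lambda>s. h s + (s - 1) * deriv h s) has_field_derivative (2 * deriv h 1)) (at 1)"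
      by (auto intro!: derivative_eq_intros dh ddh H)
    thus "(deriv H has_field_derivative (2 * deriv h 1)) (at 1)"
      by (rule has_field_derivative_transform_within_open[OF _ H(2,3)]) (simp add: dH)
  qed
  have ev: "\<forall>\<^sub>F w in at_right (0::real). w \<in> {0<..<1}"
    by (rule eventually_at_right_real) auto
  have flim: "filterlim (\<lambda>w. complex_of_real (1 - w)) (at 1) (at_right 0)"
  proof (rule filterlim_atI)
    have "((\<lambda>w. complex_of_real (1 - w)) \<longlongrightarrow> of_real (1 - 0)) (at_right 0)"
      by (intro tendsto_intros)
    thus "((\<lambda>w. complex_of_real (1 - w)) \<longlongrightarrow> 1) (at_right 0)" by simp
    show "\<forall>\<^sub>F w in at_right 0. complex_of_real (1 - w) \<noteq> 1"
      using ev by eventually_elim auto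
  qed
  have hW: "\<forall>\<^sub>F w in at_right 0. h (of_real (1 - w)) = of_real (W w)"
    using ev
  proof eventually_elim
    case (elim w)
    thus ?case using W[of w] H(4) by (auto simp: h_def field_simps)
  qed
  have "((\<lambda>w. (W w - L0) / w * w + L0) \<longlongrightarrow> L1 * 0 + L0) (at_right 0)"
    by (intro tendsto_intros lim)
  moreover have "\<forall>\<^sub>F w in at_right 0. (W w - L0) / w * w + L0 = W w"
    using ev by eventually_elim auto
  ultimately have "(W \<longlongrightarrow> L0) (at_right 0)" using Lim_transform_eventually by fastforce
  hence "((\<lambda>w. complex_of_real (W w)) \<longlongrightarrow> of_real L0) (at_right 0)" by (rule tendsto_of_real)
  moreover have "h \<midarrow>1\<rightarrow> h 1"
    using dh[OF H(3)] DERIV_isCont isCont_def by blast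
  hence "((\<lambda>w. h (of_real (1 - w))) \<longlongrightarrow> h 1) (at_right 0)"
    by (rule filterlim_compose[OF _ flim])
  hence "((\<lambda>w. complex_of_real (W w)) \<longlongrightarrow> h 1) (at_right 0)"
    using hW by (rule Lim_transform_eventually)
  ultimately have h1: "h 1 = of_real L0" using tendsto_unique by force
  have "((\<lambda>s. (h s - h 1) / (s - 1)) \<longlongrightarrow> deriv h 1) (at 1)"
    using dh[OF H(3)] by (simp add: has_field_derivative_iff)
  hence "((\<lambda>w. (h (of_real (1 - w)) - h 1) / (of_real (1 - w) - 1)) \<longlongrightarrow> deriv h 1) (at_right 0)"
    by (rule filterlim_compose[OF _ flim])
  moreover have "\<forall>\<^sub>F w in at_right 0. (h (of_real (1 - w)) - h 1) / (of_real (1 - w) - 1) =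
      complex_of_real (- ((W w - L0) / w))"
    using hW ev by eventually_elim (simp add: h1)
  ultimately have "((\<lambda>w. complex_of_real (- ((W w - L0) / w))) \<longlongrightarrow> deriv h 1) (at_right 0)"
    by (rule Lim_transform_eventually)
  moreover have "((\<lambda>w. complex_of_real (- ((W w - L0) / w))) \<longlongrightarrow> of_real (- L1)) (at_right 0)"
    by (intro tendsto_of_real tendsto_minus lim)
  ultimately have "deriv h 1 = of_real (- L1)" using tendsto_unique by force
  thus ?thesis using ddH by simp
qed

text \<open>The sine changes sign under l -> m - l. For constant g this says that the sum of the
  sines is 0.\<close>

lemma sum_sin_reflect:
  fixes g :: "nat \<Rightarrow> real"
  assumes "r < m"
  shows "(\<Sum>l=1..m-1. sin (2 * pi * real r * real l / real m) * g (m - l)) =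
         - (\<Sum>l=1..m-1. sin (2 * pi * real r * real l / real m) * g l)"
proof -
  have "(\<Sum>l=1..m-1. sin (2 * pi * real r * real l / real m) * g (m - l)) =
        (\<Sum>l=1..m-1. sin (2 * pi * real r * real (m - l) / real m) * g l)"
    by (rule sum.reindex_bij_witness[of _ "\<lambda>l. m - l" "\<lambda>l. m - l"]) auto
  also have "\<dots> = (\<Sum>l=1..m-1. - (sin (2 * pi * real r * real l / real m) * g l))"
  proof (intro sum.cong refl)
    fix l assume l: "l \<in> {1..m-1}"
    have "2 * pi * real r * real (m - l) / real m = real r * (2 * pi) - 2 * pi * real r * real l / real m"
    proof -
      have "real (m - l) = real m - real l" using l by (intro of_nat_diff) auto
      thus ?thesis using assms by (simp add: field_simps)
    qed
    moreover have "sin (real r * (2 * pi) - t) = - sin t" for t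
      using sin_integer_2pi[of "real r"] cos_integer_2pi[of "real r"] by (simp add: sin_diff mult_ac)
    ultimately show "sin (2 * pi * real r * real (m - l) / real m) * g l =
        - (sin (2 * pi * real r * real l / real m) * g l)" by simp
  qed
  finally show ?thesis by (simp add: sum_negf)
qed

text \<open>
  Up to the factor \<open>- 2\<close> the left-hand side is \<open>\<gamma>\<^sub>1(r/m) - \<gamma>\<^sub>1(1 - r/m)\<close>; it comes out by
  differentiating the functional equation at \<open>s = 1\<close>.
\<close>

lemma deriv2_hz_reg_antisymmetric:
  assumes r: "0 < r" "r < m"
  shows "deriv (deriv (hz_reg (real r / real m))) 1 - deriv (deriv (hz_reg (real (m - r) / real m))) 1 =
    of_real (- 2 * (2 * pi * (\<Sum>l=1..m-1. sin (2 * pi * real r * real l / real m) * ln_Gamma (real l / real m))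
      - pi * (ln (2 * pi * real m) + euler_mascheroni) * cot (pi * real r / real m)))"
proof -
  let ?S = "\<lambda>l. sin (2 * pi * real r * real l / real m)"
  define v where "v = real r / real m"
  have v: "0 < v" "v < 1" using r by (auto simp: v_def)
  have v': "real (m - r) / real m = 1 - v" using r by (simp add: v_def of_nat_diff diff_divide_distrib)
  \<comment> \<open>\<open>A w\<close> and \<open>B w\<close> are the two factors of the functional
    equation at s = 1 - w; \<open>A'\<close> is the derivative of \<open>A\<close> at 0, where
    Euler's constant comes from Gamma'(1), and \<open>B0\<close>, \<open>B1\<close> are the value
    and slope of \<open>B\<close> at 0+.\<close>
  define A where "A = (\<lambda>w. pi / (Gamma (1 - w) * sin (pi * (1 - w) / 2)) * (2 * pi * real m) powr (- w))"
  define B where "B = (\<lambda>w. \<Sum>l=1..m-1. ?S l * odd_hz (real l / real m) w)"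
  define A' where "A' = - pi * (ln (2 * pi * real m) + euler_mascheroni)"
  define B0 where "B0 = cot (pi * real r / real m)"
  define B1 where "B1 = 2 * (\<Sum>l=1..m-1. ?S l * ln_Gamma (real l / real m))"
  have B0: "(\<Sum>l=1..m-1. ?S l * (1 - 2 * (real l / real m))) = B0"
  proof -
    have 0: "(\<Sum>l=1..m-1. ?S l) = 0" using sum_sin_reflect[OF r(2), of "\<lambda>_. 1"] by simp
    have "(\<Sum>l=1..m-1. ?S l * (1 - 2 * (real l / real m))) =
        (\<Sum>l=1..m-1. ?S l) - 2 / real m * (\<Sum>l=1..m-1. real l * ?S l)"
      unfolding sum_distrib_left sum_subtractf [symmetric] by (intro sum.cong refl) (simp add: algebra_simps)
    thus ?thesis unfolding 0 sum_mult_sin_eq_cot[OF r] B0_def using r by simp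
  qed
  have B1: "(\<Sum>l=1..m-1. ?S l * (ln_Gamma (real l / real m) - ln_Gamma (1 - real l / real m))) = B1"
  proof -
    have "(\<Sum>l=1..m-1. ?S l * ln_Gamma (1 - real l / real m)) =
          (\<Sum>l=1..m-1. ?S l * ln_Gamma (real (m - l) / real m))"
      using r by (intro sum.cong refl) (auto simp: of_nat_diff diff_divide_distrib)
    also have "\<dots> = - (\<Sum>l=1..m-1. ?S l * ln_Gamma (real l / real m))"
      by (rule sum_sin_reflect[OF r(2)])
    finally show ?thesis unfolding B1_def right_diff_distrib sum_subtractf by simp
  qed
  have limB: "((\<lambda>w. (B w - B0) / w) \<longlongrightarrow> B1) (at_right 0)"
  proof -
    have "((\<lambda>w. \<Sum>l=1..m-1. ?S l * ((odd_hz (real l / real m) w - (1 - 2 * (real l / real m))) / w)) \<longlongrightarrow>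
       (\<Sum>l=1..m-1. ?S l * (ln_Gamma (real l / real m) - ln_Gamma (1 - real l / real m)))) (at_right 0)"
      by (intro tendsto_intros odd_hz_diff_quotient_tendsto) (use r in auto)
    moreover have "(\<Sum>l=1..m-1. ?S l * ((odd_hz (real l / real m) w - (1 - 2 * (real l / real m))) / w)) = (B w - B0) / w" for w
      unfolding B_def B0 [symmetric] sum_subtractf [symmetric] sum_divide_distrib
      by (intro sum.cong refl) (simp add: right_diff_distrib diff_divide_distrib)
    ultimately show ?thesis unfolding B1 by simp
  qed
  have "((\<lambda>w. A w) has_real_derivative A') (at 0)"
    unfolding A_def A'_def using r
    by (auto intro!: derivative_eq_intros simp: powr_def field_simps)
  moreover have "A 0 = pi" using r by (simp add: A_def)
  ultimately have "((\<lambda>w. (A w - pi) / w) \<longlongrightarrow> A') (at 0)"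
    by (simp add: has_field_derivative_iff)
  hence limA: "((\<lambda>w. (A w - pi) / w) \<longlongrightarrow> A') (at_right 0)"
    by (rule tendsto_mono[OF at_le, rotated]) simp
  have ev: "\<forall>\<^sub>F w in at_right (0::real). w \<in> {0<..<1}"
    by (rule eventually_at_right_real) auto
  have limB': "(B \<longlongrightarrow> B0) (at_right 0)"
  proof (rule Lim_transform_eventually)
    have "((\<lambda>w. (B w - B0) / w * w + B0) \<longlongrightarrow> B1 * 0 + B0) (at_right 0)"
      by (intro tendsto_intros limB)
    thus "((\<lambda>w. (B w - B0) / w * w + B0) \<longlongrightarrow> B0) (at_right 0)" by simp
    show "\<forall>\<^sub>F w in at_right 0. (B w - B0) / w * w + B0 = B w"
      using ev by eventually_elim auto
  qed
  \<comment> \<open>Product rule in difference quotients, with A 0 = pi.\<close>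
  have lim: "((\<lambda>w. (odd_hz v (1 - w) - pi * B0) / w) \<longlongrightarrow> A' * B0 + pi * B1) (at_right 0)"
  proof (rule Lim_transform_eventually)
    show "((\<lambda>w. (A w - pi) / w * B w + pi * ((B w - B0) / w)) \<longlongrightarrow> A' * B0 + pi * B1) (at_right 0)"
      by (intro tendsto_intros limA limB limB')
    show "\<forall>\<^sub>F w in at_right 0. (A w - pi) / w * B w + pi * ((B w - B0) / w) = (odd_hz v (1 - w) - pi * B0) / w"
      using ev
    proof eventually_elim
      case (elim w)
      have "odd_hz v (1 - w) = A w * B w"
        unfolding v_def A_def B_def using elim odd_hz_functional_equation[of "1 - w" r m] r by simp
      thus ?case using elim by (simp add: field_simps)
    qed
  qed
  let ?H = "\<lambda>s. hz_reg v s - hz_reg (1 - v) s"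
  have hol: "hz_reg v holomorphic_on {s. Re s > 0}" "hz_reg (1 - v) holomorphic_on {s. Re s > 0}"
    using v by (auto intro: holomorphic_hz_reg)
  have "deriv (deriv ?H) 1 = of_real (- 2 * (A' * B0 + pi * B1))"
  proof (rule deriv2_eq_of_one_sided_quotient[OF _ _ _ _ _ lim])
    show "?H holomorphic_on {s. Re s > 0}" by (intro holomorphic_intros hol)
    show "?H 1 = 0" using v by (simp add: hz_reg_at_1)
    show "?H (of_real (1 - w)) = of_real (- w * odd_hz v (1 - w))" if "0 < w" "w < 1" for w
      using hz_reg_diff_eq_odd_hz[OF v, of "1 - w"] that by simp
  qed (auto simp: open_Re_gt)
  also have "deriv (deriv ?H) 1 = deriv (deriv (hz_reg v)) 1 - deriv (deriv (hz_reg (1 - v))) 1"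
    using higher_deriv_diff[OF hol open_Re_gt, of 1 2] by (simp add: numeral_2_eq_2)
  also have "A' * B0 + pi * B1 = 2 * pi * (\<Sum>l=1..m-1. ?S l * ln_Gamma (real l / real m))
      - pi * (ln (2 * pi * real m) + euler_mascheroni) * cot (pi * real r / real m)"
    by (simp add: A'_def B0_def B1_def)
  finally show ?thesis unfolding v' unfolding v_def .
qed

theorem mainTheorem7:
  fixes m :: nat
  assumes "m \<ge> 2"
  shows "(\<Sum>r=1..m-1. of_nat r / of_nat m * stieltjes_gamma 1 (of_nat r / of_nat m)) =
     1 / 2 * ((of_nat m - 1) * stieltjes_gamma 1 1
              - of_real (real m * euler_mascheroni * ln (real m))
              - of_real (real m / 2 * (ln (real m))\<^sup>2))
     - of_real (pi / (2 * real m) * (euler_mascheroni + ln (2 * pi * real m))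
                * (\<Sum>l=1..m-1. real l * cot (pi * real l / real m)))
     - of_real (pi / 2
                * (\<Sum>l=1..m-1. cot (pi * real l / real m) * ln (Gamma (real l / real m))))"
proof -
  \<comment> \<open>\<open>e r\<close> is - 2 gamma_1(r/m), and \<open>d r\<close> below is
    gamma_1(r/m) - gamma_1(1 - r/m).\<close>
  define e where "e = (\<lambda>r. deriv (deriv (hz_reg (real r / real m))) 1)"
  define e1 where "e1 = deriv (deriv (hz_reg 1)) 1"
  let ?L = "ln (real m)" and ?\<gamma> = "euler_mascheroni :: real"
  define Cs where "Cs = (\<Sum>l=1..m-1. real l * cot (pi * real l / real m))"
  define Gs where "Gs = (\<Sum>l=1..m-1. cot (pi * real l / real m) * ln (Gamma (real l / real m)))"
  define d where "d = (\<lambda>r. 2 * pi * (\<Sum>l=1..m-1. sin (2 * pi * real r * real l / real m) * ln_Gamma (real l / real m))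
      - pi * (ln (2 * pi * real m) + ?\<gamma>) * cot (pi * real r / real m))"
  have m: "m > 0" using assms by simp
  have st1: "stieltjes_gamma 1 1 = - e1 / 2"
    using stieltjes_gamma_1_eq_hz_reg[of 1] by (simp add: e1_def)
  have st: "stieltjes_gamma 1 (of_nat r / of_nat m) = - e r / 2" if "r \<in> {1..m-1}" for r
    using stieltjes_gamma_1_eq_hz_reg[of "real r / real m"] that m by (simp add: e_def)
  \<comment> \<open>The distribution relation includes r = m, that is v = 1, which accounts for the
    separate summand \<open>e1\<close>.\<close>
  have "{1..m} = insert m {1..m-1}" using m by auto
  hence "(\<Sum>r=1..m. e r) = e m + (\<Sum>r=1..m-1. e r)" using m by simp
  also have "e m = e1" using m by (simp add: e_def e1_def)
  finally have sum_e: "(\<Sum>r=1..m-1. e r) =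
     of_nat m * (of_real (?L\<^sup>2) + 2 * of_real ?L * euler_mascheroni + e1) - e1"
    using deriv2_hz_reg_distribution[OF m] unfolding e_def [symmetric] e1_def [symmetric]
    by (metis add_diff_cancel_left')
  have anti: "e r - e (m - r) = of_real (- 2 * d r)" if "r \<in> {1..m-1}" for r
    using deriv2_hz_reg_antisymmetric[of r m] that by (simp only: e_def d_def) auto
  define T where "T = (\<Sum>r=1..m-1. of_nat r / of_nat m * e r)"
  have "T = (\<Sum>r=1..m-1. of_nat (m - r) / of_nat m * e (m - r))"
    unfolding T_def by (rule sum.reindex_bij_witness[of _ "\<lambda>l. m - l" "\<lambda>l. m - l"]) auto
  also have "\<dots> = (\<Sum>r=1..m-1. e (m - r)) - (\<Sum>r=1..m-1. of_nat r / of_nat m * e (m - r))"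
    unfolding sum_subtractf [symmetric]
    by (intro sum.cong refl) (use m in \<open>auto simp: of_nat_diff field_simps\<close>)
  also have "(\<Sum>r=1..m-1. e (m - r)) = (\<Sum>r=1..m-1. e r)"
    by (rule sum.reindex_bij_witness[of _ "\<lambda>l. m - l" "\<lambda>l. m - l"]) auto
  finally have "2 * T = (\<Sum>r=1..m-1. e r) + (\<Sum>r=1..m-1. of_nat r / of_nat m * (e r - e (m - r)))"
    by (simp add: T_def right_diff_distrib sum_subtractf)
  also have "(\<Sum>r=1..m-1. of_nat r / of_nat m * (e r - e (m - r))) =
      of_real (- 2 * (\<Sum>r=1..m-1. real r / real m * d r))"
    unfolding sum_distrib_left of_real_sum
    by (intro sum.cong refl) (simp add: anti)
  also have "(\<Sum>r=1..m-1. real r / real m * d r) =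
      - pi * Gs - pi / real m * (ln (2 * pi * real m) + ?\<gamma>) * Cs"
  proof -
    have "(\<Sum>r=1..m-1. real r / real m * d r) =
      2 * pi / real m * (\<Sum>r=1..m-1. \<Sum>l=1..m-1. ln_Gamma (real l / real m) * (real r * sin (2 * pi * real l * real r / real m)))
      - pi / real m * (ln (2 * pi * real m) + ?\<gamma>) * Cs"
      unfolding Cs_def d_def sum_distrib_left right_diff_distrib sum_subtractf by (simp add: mult_ac)
    \<comment> \<open>The sine is symmetric in r and l, so after exchanging the sums the inner one
      over r is again a cotangent, now at l.\<close>
    also have "(\<Sum>r=1..m-1. \<Sum>l=1..m-1. ln_Gamma (real l / real m) * (real r * sin (2 * pi * real l * real r / real m)))
      = (\<Sum>l=1..m-1. ln_Gamma (real l / real m) * (\<Sum>r=1..m-1. real r * sin (2 * pi * real l * real r / real m)))"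
      by (subst sum.swap) (simp add: sum_distrib_left)
    also have "\<dots> = (\<Sum>l=1..m-1. - (real m / 2) * (cot (pi * real l / real m) * ln (Gamma (real l / real m))))"
    proof (intro sum.cong refl)
      fix l assume l: "l \<in> {1..m-1}"
      show "ln_Gamma (real l / real m) * (\<Sum>r=1..m-1. real r * sin (2 * pi * real l * real r / real m)) =
        - (real m / 2) * (cot (pi * real l / real m) * ln (Gamma (real l / real m)))"
        using l m by (subst sum_mult_sin_eq_cot) (auto simp: ln_Gamma_real_pos)
    qed
    also have "\<dots> = - (real m / 2) * Gs" unfolding Gs_def sum_distrib_left ..
    finally show ?thesis using m by simp
  qed
  finally have T: "2 * T = of_nat m * (of_real (?L\<^sup>2) + 2 * of_real ?L * euler_mascheroni + e1) - e1
     + of_real (- 2 * (- pi * Gs - pi / real m * (ln (2 * pi * real m) + ?\<gamma>) * Cs))"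
    unfolding sum_e .
  have "(\<Sum>r=1..m-1. of_nat r / of_nat m * stieltjes_gamma 1 (of_nat r / of_nat m)) = - (2 * T) / 4"
    unfolding T_def sum_divide_distrib sum_negf [symmetric] sum_distrib_left
    by (intro sum.cong refl) (simp only: st, simp)
  also have "\<dots> = 1 / 2 * ((of_nat m - 1) * stieltjes_gamma 1 1
              - of_real (real m * ?\<gamma> * ?L) - of_real (real m / 2 * ?L\<^sup>2))
     - of_real (pi / (2 * real m) * (?\<gamma> + ln (2 * pi * real m)) * Cs) - of_real (pi / 2 * Gs)"
  proof -
    define P where "P = pi / real m"
    have P2: "pi / (2 * real m) = P / 2" by (simp add: P_def)
    thus ?thesis unfolding T st1 P2 P_def [symmetric] by (simp add: field_simps)
  qed
  finally show ?thesis unfolding Cs_def Gs_def .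
qed

end
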